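(* Let $(\varphi_{s,t})$ be an evolution family of some order $d\in[1,+\infty]$ and let $\beta:=\lim_{t\to+\infty}\frac{|\varphi_{0,t}'(0)|}{1-|\varphi_{0,t}(0)|^2}$. Then: (1) there is a unique standard Loewner chain $(f_t)$ associated with $(\varphi_{s,t})$; (2) if $\beta=0$, there is a unique normalized Loewner chain associated with $(\varphi_{s,t})$ (namely the standard one); (3) if $\beta>0$ and $(g_t)$ is a normalized Loewner chain associated with $(\varphi_{s,t})$, then there is $h\in\mathcal S$ such that $g_t(z)=h(\beta f_t(z))/\beta$ for all $t\ge0$, $z\in\mathbb D$, where $(f_t)$ is the unique standard Loewner chain associated with $(\varphi_{s,t})$.
   Context: $\mathbb D$ is the open unit disk; $\mathcal S$ is the class of univalent holomorphic $h:\mathbb D\to\mathbb C$ with $h(0)=h'(0)-1=0$. For $d\in[1,+\infty]$, an evolution family of order $d$ is a family $(\varphi_{s,t})_{0\le s\le t<+\infty}$ of holomorphic self-maps of $\mathbb D$ with $\varphi_{s,s}=\mathrm{id}_{\mathbb D}$, $\varphi_{s,t}=\varphi_{u,t}\circ\varphi_{s,u}$ for $0\le s\le u\le t$, and such that for every $z\in\mathbb D$, $T>0$ there is a non-negative $k_{z,T}\in L^d([0,T])$ with $|\varphi_{s,u}(z)-\varphi_{s,t}(z)|\le\int_u^tk_{z,T}$ for all $0\le s\le u\le t\le T$. A Loewner chain (of some order $d'\in[1,+\infty]$) is a family $(f_t)_{t\ge0}$ of univalent holomorphic maps $f_t:\mathbb D\to\mathbb C$ with $f_s(\mathbb D)\subset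 f_t(\mathbb D)$ for $s<t$ and such that for every compact $K\subset\mathbb D$ and $T>0$ there is a non-negative $k_{K,T}\in L^{d'}([0,T])$ with $|f_s(z)-f_t(z)|\le\int_s^tk_{K,T}$ for $z\in K$, $0\le s\le t\le T$. It is normalized if $f_0(0)=0$, $f_0'(0)=1$, and associated with $(\varphi_{s,t})$ if $f_t\circ\varphi_{s,t}=f_s$ for all $0\le s\le t$. A normalized Loewner chain $(f_t)$ associated with $(\varphi_{s,t})$ is standard if $\bigcup_{t\ge0}f_t(\mathbb D)=\{z:|z|<1/\beta\}$, interpreted as $\mathbb C$ when $\beta=0$. *)

theory Defs
  imports "HOL-Analysis.Analysis"
begin

abbreviation unit_disk :: "complex set" where "unit_disk \<equiv> ball 0 1"

definition nonneg_Ld :: "ereal \<Rightarrow> real \<Rightarrow> (real \<Rightarrow> real) \<Rightarrow> bool" where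
  "nonneg_Ld d T k \<longleftrightarrow>
     (\<forall>x\<in>{0..T}. 0 \<le> k x) \<and>
     set_borel_measurable lebesgue {0..T} k \<and>
     (if d = \<infinity> then (\<exists>C. AE x in lebesgue. x \<in> {0..T} \<longrightarrow> \<bar>k x\<bar> \<le> C)
      else set_integrable lebesgue {0..T} (\<lambda>x. \<bar>k x\<bar> powr real_of_ereal d))"

definition evolution_family :: "ereal \<Rightarrow> (real \<Rightarrow> real \<Rightarrow> complex \<Rightarrow> complex) \<Rightarrow> bool" where
  "evolution_family d \<phi> \<longleftrightarrow>
     (\<forall>s t. 0 \<le> s \<and> s \<le> t \<longrightarrow> \<phi> s t holomorphic_on unit_disk \<and> \<phi> s t ` unit_disk \<subseteq> unit_disk) \<and>
     (\<forall>s\<ge>0. \<forall>z\<in>unit_disk. \<phi> s s z = z) \<and>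
     (\<forall>s u t. 0 \<le> s \<and> s \<le> u \<and> u \<le> t \<longrightarrow> (\<forall>z\<in>unit_disk. \<phi> s t z = \<phi> u t (\<phi> s u z))) \<and>
     (\<forall>z\<in>unit_disk. \<forall>T>0. \<exists>k. nonneg_Ld d T k \<and>
        (\<forall>s u t. 0 \<le> s \<and> s \<le> u \<and> u \<le> t \<and> t \<le> T \<longrightarrow>
           cmod (\<phi> s u z - \<phi> s t z) \<le> integral {u..t} k))"

definition loewner_chain_order :: "ereal \<Rightarrow> (real \<Rightarrow> complex \<Rightarrow> complex) \<Rightarrow> bool" where
  "loewner_chain_order d f \<longleftrightarrow>
     (\<forall>t\<ge>0. f t holomorphic_on unit_disk \<and> inj_on (f t) unit_disk) \<and>
     (\<forall>s t. 0 \<le> s \<and> s < t \<longrightarrow> f s ` unit_disk \<subseteq> f t ` unit_disk) \<and>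
     (\<forall>K T. compact K \<and> K \<subseteq> unit_disk \<and> T > 0 \<longrightarrow>
        (\<exists>k. nonneg_Ld d T k \<and>
           (\<forall>z\<in>K. \<forall>s t. 0 \<le> s \<and> s \<le> t \<and> t \<le> T \<longrightarrow>
              cmod (f s z - f t z) \<le> integral {s..t} k)))"

definition loewner_chain :: "(real \<Rightarrow> complex \<Rightarrow> complex) \<Rightarrow> bool" where
  "loewner_chain f \<longleftrightarrow> (\<exists>d. 1 \<le> d \<and> loewner_chain_order d f)"

definition normalized_chain :: "(real \<Rightarrow> complex \<Rightarrow> complex) \<Rightarrow> bool" where
  "normalized_chain f \<longleftrightarrow> loewner_chain f \<and> f 0 0 = 0 \<and> deriv (f 0) 0 = 1"

definition associated_with ::
  "(real \<Rightarrow> complex \<Rightarrow> complex) \<Rightarrow> (real \<Rightarrow> real \<Rightarrow> complex \<Rightarrow> complex) \<Rightarrow> bool" where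
  "associated_with f \<phi> \<longleftrightarrow>
     (\<forall>s t. 0 \<le> s \<and> s \<le> t \<longrightarrow> (\<forall>z\<in>unit_disk. f t (\<phi> s t z) = f s z))"

text \<open>Standard Loewner chain, relative to the number beta attached to the evolution family.\<close>
definition standard_chain ::
  "real \<Rightarrow> (real \<Rightarrow> complex \<Rightarrow> complex) \<Rightarrow> (real \<Rightarrow> real \<Rightarrow> complex \<Rightarrow> complex) \<Rightarrow> bool" where
  "standard_chain \<beta> f \<phi> \<longleftrightarrow> normalized_chain f \<and> associated_with f \<phi> \<and>
     (\<Union>t\<in>{0..}. f t ` unit_disk) = (if \<beta> = 0 then UNIV else ball 0 (1 / \<beta>))"

definition class_S :: "(complex \<Rightarrow> complex) \<Rightarrow> bool" where
  "class_S h \<longleftrightarrow> h holomorphic_on unit_disk \<and> inj_on h unit_disk \<and> h 0 = 0 \<and> deriv h 0 = 1"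

end

theory Submission
  imports Defs "HOL-Complex_Analysis.Complex_Analysis"
begin

text \<open>
  Conjugating the evolution family by disk automorphisms that move the orbit of \<open>0\<close> back to \<open>0\<close> gives a
  family \<open>\<psi>\<close> of univalent self-maps fixing the origin, and with \<open>b t = (\<psi> 0 t)' 0\<close> the modulus of
  \<open>b t\<close> decreases to \<open>\<beta>\<close>. The standard chain is the limit of \<open>\<psi> s t / b t\<close> as \<open>t\<close> tends to infinity. The limit
  exists for \<open>\<beta> = 0\<close> because \<open>G w - w = O(\<bar>w\<bar>\<^sup>2)\<close> uniformly on the class \<open>S\<close>, and for \<open>\<beta> > 0\<close>
  because a normalized map into a disk of radius close to \<open>1\<close> is close to the identity. The first
  estimate applies to every normalized chain, which gives uniqueness for \<open>\<beta> = 0\<close>; for \<open>\<beta> > 0\<close> two chains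
  differ by a univalent map of the union of the ranges.

  The pointwise regularity hypothesis becomes uniform on compact sets since the displacement of a self-map
  of the disk is controlled by its displacement at two points.
\<close>

section \<open>Self-maps of the disk and the class S\<close>

text \<open>Transition maps only run forward in time, so a chain must be found at infinity. Division
  by \<open>b t\<close> fixes the derivative of \<open>\<psi> s t\<close> at 0 to be
  \<open>1 / b s\<close>, and passing from t to t' then inserts a map of class S. If \<beta> = 0,
  this map acts at a point of size O(|b t|); its quadratic error is O(|b t|^2), hence still O(|b t|)
  after division by \<open>b t\<close>. If \<beta> > 0, that error need not vanish, but the inserted
  map is bounded by |b t| / \<beta>, which tends to 1, and the rigidity in the Schwarz lemma takes
  over.

  Univalence is not part of the definition of an evolution family. It comes from the same
  displacement estimate as the regularity of the chain: over short times the maps are uniformly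
  close to the identity on the relevant compact sets, and a map close to the identity is injective
  on a smaller disk.

  The constants for the class S are qualitative; only their independence of the function
  matters.\<close>

lemma le_mult_epsI:
  fixes x y c :: real
  assumes "\<And>e. e > 0 \<Longrightarrow> x \<le> y + c * e"
  shows "x \<le> y"
proof (rule field_le_epsilon)
  fix e :: real assume "e > 0"
  have "c * (e / (\<bar>c\<bar> + 1)) \<le> \<bar>c\<bar> * (e / (\<bar>c\<bar> + 1))"
    using \<open>e > 0\<close> by (intro mult_right_mono) auto
  also have "\<dots> \<le> e"
    using \<open>e > 0\<close> by (simp add: field_simps)
  finally show "x \<le> y + e"
    using assms[of "e / (\<bar>c\<bar> + 1)"] \<open>e > 0\<close> by (auto simp: add_pos_nonneg)
qed

section \<open>The Schwarz lemma, Harnack's inequality and displacement of self-maps\<close>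

lemma Schwarz_le:
  assumes f: "f holomorphic_on unit_disk" "f 0 = 0"
    and B: "\<And>z. norm z < 1 \<Longrightarrow> norm (f z) \<le> B"
  shows "norm z < 1 \<Longrightarrow> norm (f z) \<le> B * norm z" and "norm (deriv f 0) \<le> B"
proof -
  have "B \<ge> 0" using B[of 0] f by simp
  have *: "(norm z < 1 \<longrightarrow> norm (f z) \<le> (B + e) * norm z) \<and> norm (deriv f 0) \<le> B + e"
    if e: "e > 0" for e
  proof -
    \<comment> \<open>Dividing by \<open>B + e\<close> instead of \<open>B\<close> makes the bound
      strict, as the Schwarz lemma requires, and also covers \<open>B = 0\<close>.\<close>
    define g where "g = (\<lambda>z. f z / of_real (B + e))"
    have Be: "B + e > 0" using \<open>B \<ge> 0\<close> e by simp
    have g: "g holomorphic_on ball 0 1" "g 0 = 0"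
      unfolding g_def using f Be by (auto intro!: holomorphic_intros simp flip: of_real_add)
    have lt: "norm (g z) < 1" if "norm z < 1" for z
      using B[OF that] Be e by (simp add: g_def norm_divide flip: of_real_add)
    have "deriv g 0 = deriv f 0 / of_real (B + e)"
      unfolding g_def
      using holomorphic_derivI[OF f(1), of 0] by (auto intro!: DERIV_imp_deriv DERIV_cdivide)
    then have "norm (deriv f 0) / (B + e) \<le> 1"
      using Schwarz_Lemma(2)[OF g lt, of 0] Be by (simp add: norm_divide flip: of_real_add)
    moreover have "norm (f z) / (B + e) \<le> norm z" if "norm z < 1"
      using Schwarz_Lemma(1)[OF g lt that] Be by (simp add: g_def norm_divide flip: of_real_add)
    ultimately show ?thesis
      using Be by (simp add: pos_divide_le_eq mult.commute)
  qed
  show "norm (f z) \<le> B * norm z" if "norm z < 1"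
    by (rule le_mult_epsI[where c = "norm z"]) (use * that in \<open>auto simp: algebra_simps\<close>)
  show "norm (deriv f 0) \<le> B"
    by (rule le_mult_epsI[where c = 1]) (use * in auto)
qed

text \<open>Dividing by \<open>z\<close> does not enlarge the bound and turns a condition on the
  derivative at 0 into one on the value at 0, so that Schwarz or Harnack can be applied a second
  time.\<close>

lemma Schwarz_quotient:
  assumes f: "f holomorphic_on unit_disk" "f 0 = 0"
    and B: "\<And>z. norm z < 1 \<Longrightarrow> norm (f z) \<le> B"
  obtains q where "q holomorphic_on unit_disk" "q 0 = deriv f 0"
    "\<And>z. f z = z * q z" "\<And>z. norm z < 1 \<Longrightarrow> norm (q z) \<le> B"
proof
  let ?q = "\<lambda>z. if z = 0 then deriv f 0 else (f z - f 0) / (z - 0)"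
  show "?q holomorphic_on unit_disk"
    by (rule pole_lemma_open[OF f(1)]) simp
  show "norm (?q z) \<le> B" if "norm z < 1" for z
    using Schwarz_le(1)[OF f B that] Schwarz_le(2)[OF f B] f(2)
    by (auto simp: norm_divide field_simps)
qed (use f in auto)

text \<open>After a shift by \<open>e\<close> into the open right half-plane, the Cayley transform
  \<open>m\<close> sends the value at 0 to 0 and the half-plane to the disk. The Schwarz lemma for
  \<open>m\<close>, solved for the original function, is the claim.\<close>

lemma Harnack_norm:
  assumes p: "p holomorphic_on unit_disk" and Re: "\<And>z. norm z < 1 \<Longrightarrow> Re (p z) \<ge> 0"
    and z: "norm z < 1"
  shows "(1 - norm z) * norm (p z) \<le> (1 + norm z) * norm (p 0)"
proof (rule le_mult_epsI)
  fix e :: real assume e: "e > 0"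
  define q where "q = (\<lambda>z. p z + of_real e)"
  have Req: "Re (q z) > 0" if "norm z < 1" for z
    using Re[OF that] e by (simp add: q_def)
  have ne: "q z + cnj (q 0) \<noteq> 0" if "norm z < 1" for z
    using Req[OF that] Req[of 0] by (auto simp: complex_eq_iff)
  define m where "m = (\<lambda>z. (q z - q 0) / (q z + cnj (q 0)))"
  have m: "m holomorphic_on unit_disk"
    unfolding m_def q_def using p ne by (auto intro!: holomorphic_intros simp: q_def)
  have m1: "norm (m z) < 1" if "norm z < 1" for z
  proof -
    have "(norm (q z + cnj (q 0)))\<^sup>2 - (norm (q z - q 0))\<^sup>2 = 4 * Re (q z) * Re (q 0)"
      unfolding cmod_power2 by (simp add: power2_eq_square algebra_simps)
    also have "\<dots> > 0" using Req[OF that] Req[of 0] by simp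
    finally have "(norm (q z - q 0))\<^sup>2 < (norm (q z + cnj (q 0)))\<^sup>2" by simp
    then have "norm (q z - q 0) < norm (q z + cnj (q 0))"
      using norm_ge_zero power_less_imp_less_base by blast
    then show ?thesis using ne[OF that] by (simp add: m_def norm_divide)
  qed
  have "norm (m z) \<le> norm z"
    using Schwarz_Lemma(1)[OF m _ m1] z by (simp add: m_def)
  then have "norm (q z - q 0) \<le> norm z * norm (q z + cnj (q 0))"
    using ne[OF z] by (simp add: m_def norm_divide field_simps)
  also have "\<dots> \<le> norm z * (norm (q z) + norm (q 0))"
    by (intro mult_left_mono) (metis norm_triangle_ineq complex_mod_cnj, simp)
  finally have "norm (q z) - norm (q 0) \<le> norm z * (norm (q z) + norm (q 0))"
    using norm_triangle_ineq2[of "q z" "q 0"] by linarith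
  then have *: "(1 - norm z) * norm (q z) \<le> (1 + norm z) * norm (q 0)"
    by (simp add: algebra_simps)
  have a: "norm (q 0) \<le> norm (p 0) + e"
    using e norm_triangle_ineq[of "p 0" "of_real e"] by (simp add: q_def)
  have b: "norm (p z) - e \<le> norm (q z)"
    using e norm_triangle_ineq2[of "p z" "- of_real e"] by (simp add: q_def)
  have "(1 - norm z) * (norm (p z) - e) \<le> (1 + norm z) * (norm (p 0) + e)"
    by (intro order.trans[OF mult_left_mono[OF b]] order.trans[OF *] mult_left_mono a)
       (use z in \<open>auto simp: add_nonneg_nonneg\<close>)
  then show "(1 - norm z) * norm (p z) \<le> (1 + norm z) * norm (p 0) + 2 * e"
    by (simp add: algebra_simps)
qed

text \<open>The reciprocal of a function with positive real part again has positive real part, so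
  Harnack's upper bound for it is a lower bound here. The factor 3 is (1 + 1/2) / (1 - 1/2).\<close>

lemma Harnack_norm_half:
  assumes p: "p holomorphic_on unit_disk" and Re: "\<And>z. norm z < 1 \<Longrightarrow> Re (p z) \<ge> 0"
  shows "norm (p 0) \<le> 3 * norm (p (1/2))"
proof (rule le_mult_epsI)
  fix e :: real assume e: "e > 0"
  define q where "q = (\<lambda>z. p z + of_real e)"
  have Req: "Re (q z) > 0" if "norm z < 1" for z
    using Re[OF that] e by (simp add: q_def)
  have ne: "q z \<noteq> 0" if "norm z < 1" for z
    using Req[OF that] by auto
  have "(1 - norm (1/2::complex)) * norm (inverse (q (1/2))) \<le> (1 + norm (1/2::complex)) * norm (inverse (q 0))"
  proof (rule Harnack_norm)
    show "(\<lambda>z. inverse (q z)) holomorphic_on unit_disk"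
      unfolding q_def using p ne by (auto intro!: holomorphic_intros simp: q_def)
    show "Re (inverse (q z)) \<ge> 0" if "norm z < 1" for z
      using Req[OF that] by (simp add: inverse_complex.sel)
  qed (simp add: norm_divide)
  then have "norm (q 0) \<le> 3 * norm (q (1/2))"
    using ne[of 0] ne[of "1/2"] by (simp add: norm_inverse norm_divide field_simps)
  moreover have "norm (p 0) - e \<le> norm (q 0)"
    using e norm_triangle_ineq2[of "p 0" "- of_real e"] by (simp add: q_def)
  moreover have "norm (q (1/2)) \<le> norm (p (1/2)) + e"
    using e norm_triangle_ineq[of "p (1/2)" "of_real e"] by (simp add: q_def)
  ultimately show "norm (p 0) \<le> 3 * norm (p (1/2)) + 4 * e" by simp
qed

text \<open>For a self-map \<open>\<phi>\<close> of the disk, \<open>G = id - \<phi>\<close> is an infinitesimal generator, so by Berkson and Porta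
  \<open>G z = a - cnj a * z\<^sup>2 + z * p z\<close> with \<open>a = G 0\<close> and \<open>Re p \<ge> 0\<close>. Harnack's inequality for \<open>p\<close> then
  controls \<open>G\<close> by its values at the two points \<open>0\<close> and \<open>1/2\<close>.\<close>

lemma displacement_bound:
  assumes \<phi>: "\<phi> holomorphic_on unit_disk" "\<And>z. norm z < 1 \<Longrightarrow> norm (\<phi> z) < 1"
    and z: "norm z \<le> r" and r: "r < 1"
  shows "norm (\<phi> z - z) \<le> 17 / (1 - r) * (norm (\<phi> 0) + norm (\<phi> (1/2) - 1/2))"
proof -
  define a where "a = - \<phi> 0"
  define F where "F = (\<lambda>z. z - \<phi> z + cnj a * z\<^sup>2)"
  define p where "p = (\<lambda>z. if z = 0 then deriv F 0 else (F z - F 0) / (z - 0))"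
  have F: "F holomorphic_on unit_disk"
    unfolding F_def by (intro holomorphic_intros \<phi>)
  have p: "p holomorphic_on unit_disk"
    unfolding p_def by (rule pole_lemma_open[OF F]) simp
  have pF: "z * p z = z - \<phi> z + cnj a * z\<^sup>2 - a" for z
    by (auto simp: p_def F_def a_def)
  have a1: "norm a < 1" using \<phi>(2)[of 0] by (simp add: a_def)
  \<comment> \<open>After multiplication by \<open>cnj z\<close>, the real parts of the two terms
    containing \<open>a\<close> cancel up to the factor 1 - r^2. This is the purpose of the summand
    \<open>cnj a * z\<^sup>2\<close> in \<open>F\<close>.\<close>
  have bdry: "- Re (p z) \<le> (1 - r) * 3 / r\<^sup>2" if zr: "norm z = r" "0 < r" "r < 1" for z r
  proof -
    have Re_of_real_mult: "Re (of_real c * w) = c * Re w" for c w by simp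
    have zz: "cnj z * z = of_real (r\<^sup>2)"
      using zr complex_norm_square[of z] by (simp add: mult.commute)
    have "of_real (r\<^sup>2) * p z = cnj z * (z * p z)"
      using zz by (simp add: mult.assoc[symmetric])
    also have "\<dots> = cnj z * z - cnj z * \<phi> z + cnj a * z * (cnj z * z) - cnj z * a"
      unfolding pF by (simp add: algebra_simps power2_eq_square)
    also have "\<dots> = of_real (r\<^sup>2) - cnj z * \<phi> z + of_real (r\<^sup>2) * (cnj a * z) - cnj (cnj a * z)"
      unfolding zz by (simp add: mult_ac)
    finally have "Re (of_real (r\<^sup>2) * p z) = Re (of_real (r\<^sup>2) - cnj z * \<phi> z + of_real (r\<^sup>2) * (cnj a * z) - cnj (cnj a * z))"
      by simp
    then have eq: "r\<^sup>2 * Re (p z) = r\<^sup>2 - Re (cnj z * \<phi> z) - (1 - r\<^sup>2) * Re (cnj a * z)"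
      unfolding minus_complex.sel plus_complex.sel cnj.sel Re_complex_of_real Re_of_real_mult
      by (simp only: algebra_simps mult_1)
    have "Re (cnj z * \<phi> z) \<le> norm z * norm (\<phi> z)"
      using complex_Re_le_cmod[of "cnj z * \<phi> z"] by (simp add: norm_mult)
    also have "\<dots> \<le> r" using \<phi>(2)[of z] zr by (simp add: mult_left_le)
    finally have 1: "Re (cnj z * \<phi> z) \<le> r" .
    have "Re (cnj a * z) \<le> norm a * norm z"
      using complex_Re_le_cmod[of "cnj a * z"] by (simp add: norm_mult)
    also have "\<dots> \<le> 1 * 1" using a1 zr by (intro mult_mono) auto
    finally have 2: "(1 - r\<^sup>2) * Re (cnj a * z) \<le> (1 - r\<^sup>2) * 1"
      using zr by (intro mult_left_mono) (auto simp: power_le_one)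
    have "r\<^sup>2 * (- Re (p z)) \<le> (1 - r) * r + (1 - r\<^sup>2)"
      using 1 2 eq by (simp add: algebra_simps power2_eq_square)
    also have "\<dots> = (1 - r) * (1 + 2 * r)"
      by (simp add: algebra_simps power2_eq_square)
    also have "\<dots> \<le> (1 - r) * 3"
      using zr by (intro mult_left_mono) auto
    finally show ?thesis using zr by (simp add: field_simps)
  qed
  \<comment> \<open>The maximum principle for \<open>exp (- p)\<close>, whose modulus is the
    exponential of -Re p, carries \<open>bdry\<close> inside the circle; the bound tends to 0 as the
    radius tends to 1.\<close>
  have Rep: "Re (p \<xi>) \<ge> 0" if \<xi>: "norm \<xi> < 1" for \<xi>
  proof -
    have "- Re (p \<xi>) \<le> (1 - r) * 3 / r\<^sup>2" if r: "norm \<xi> < r" "r < 1" for r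
    proof -
      have r0: "r > 0" using r norm_ge_zero[of \<xi>] by linarith
      have sub: "cball 0 r \<subseteq> (unit_disk :: complex set)" using r by auto
      have h: "(\<lambda>z. exp (- p z)) holomorphic_on unit_disk"
        by (intro holomorphic_intros p)
      have "norm (exp (- p \<xi>)) \<le> exp ((1 - r) * 3 / r\<^sup>2)"
      proof (rule maximum_modulus_frontier[where S = "cball 0 r" and f = "\<lambda>z. exp (- p z)"])
        show "(\<lambda>z. exp (- p z)) holomorphic_on interior (cball 0 r)"
          using h sub holomorphic_on_subset interior_subset by (metis (no_types, lifting) subset_trans)
        show "continuous_on (closure (cball 0 r)) (\<lambda>z. exp (- p z))"
          using h sub by (auto intro: holomorphic_on_imp_continuous_on holomorphic_on_subset)
        show "norm (exp (- p z)) \<le> exp ((1 - r) * 3 / r\<^sup>2)" if "z \<in> frontier (cball 0 r)" for z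
          using that bdry[of z r] r0 r by (simp add: frontier_cball)
      qed (use r in auto)
      then show ?thesis by simp
    qed
    then have ev: "eventually (\<lambda>r. - Re (p \<xi>) \<le> (1 - r) * 3 / r\<^sup>2) (at_left 1)"
      using \<xi> by (auto simp: eventually_at_left_field)
    have "((\<lambda>r. (1 - r) * 3 / r\<^sup>2) \<longlongrightarrow> (1 - 1) * 3 / 1\<^sup>2) (at_left (1::real))"
      by (intro tendsto_intros) auto
    from tendsto_lowerbound[OF this ev] show ?thesis by simp
  qed
  have r0: "r \<ge> 0" using z norm_ge_zero[of z] by linarith
  let ?S = "norm (\<phi> 0) + norm (\<phi> (1/2) - 1/2)"
  \<comment> \<open>Origin of 17: \<open>pF\<close> at 1/2 gives 5/2, Harnack from 1/2 back to 0
    gives 3, and Harnack from 0 to \<open>z\<close> gives \<open>1 + norm z\<close>, at most 2. This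
    makes 15, and the two terms in \<open>a\<close> add 2.\<close>
  have "norm (p (1/2)) = 2 * norm (1/2 * p (1/2))"
    by (simp add: norm_divide)
  also have "\<dots> = 2 * norm ((1/2 - \<phi> (1/2)) + (cnj a * (1/2)\<^sup>2 - a))"
    unfolding pF by (simp add: algebra_simps)
  also have "\<dots> \<le> 2 * (norm (1/2 - \<phi> (1/2)) + (norm (cnj a * (1/2)\<^sup>2) + norm a))"
    by (intro mult_left_mono order.trans[OF norm_triangle_ineq] add_left_mono norm_triangle_ineq4) auto
  also have "\<dots> = 2 * norm (\<phi> (1/2) - 1/2) + 5/2 * norm (\<phi> 0)"
    by (simp add: norm_mult norm_power a_def norm_divide norm_minus_commute power2_eq_square)
  also have "\<dots> \<le> 5/2 * ?S" by simp
  finally have ph: "norm (p (1/2)) \<le> 5/2 * ?S" .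
  have z1: "norm z < 1" using z r by simp
  have "(1 - r) * norm (p z) \<le> (1 - norm z) * norm (p z)"
    using z by (intro mult_right_mono) auto
  also have "\<dots> \<le> (1 + norm z) * norm (p 0)"
    by (rule Harnack_norm[OF p Rep z1])
  also have "\<dots> \<le> 2 * (3 * (5/2 * ?S))"
    using Harnack_norm_half[OF p Rep] ph z1 by (intro mult_mono) auto
  finally have pz: "(1 - r) * norm (p z) \<le> 15 * ?S" by simp
  have "norm (\<phi> z - z) = norm ((a - cnj a * z\<^sup>2) + z * p z)"
    unfolding pF by (simp add: norm_minus_commute)
  also have "\<dots> \<le> (norm a + norm (cnj a * z\<^sup>2)) + norm (z * p z)"
    by (intro order.trans[OF norm_triangle_ineq] add_right_mono norm_triangle_ineq4)
  also have "norm (cnj a * z\<^sup>2) \<le> norm a * 1"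
    using z1 by (simp add: norm_mult norm_power mult_left_le power_le_one)
  also have "norm (z * p z) \<le> 1 * norm (p z)"
    unfolding norm_mult using z1 by (intro mult_right_mono) auto
  finally have "norm (\<phi> z - z) \<le> 2 * norm a + norm (p z)" by simp
  then have "(1 - r) * norm (\<phi> z - z) \<le> (1 - r) * (2 * norm a + norm (p z))"
    using r by (intro mult_left_mono) auto
  also have "\<dots> = (1 - r) * (2 * norm a) + (1 - r) * norm (p z)"
    by (simp add: algebra_simps)
  also have "\<dots> \<le> 1 * (2 * norm a) + 15 * ?S"
    using r0 pz by (intro add_mono mult_right_mono) auto
  also have "\<dots> \<le> 17 * ?S" by (simp add: a_def)
  finally show ?thesis using r by (simp add: field_simps)
qed

section \<open>Normalized maps compared with the identity\<close>

lemma norm_diff_id_le_quadratic: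
  assumes f: "f holomorphic_on unit_disk" "f 0 = 0" "deriv f 0 = 1"
    and A: "\<And>z. norm z < 1 \<Longrightarrow> norm (f z) \<le> A" and z: "norm z < 1"
  shows "norm (f z - z) \<le> (A + 1) * (norm z)\<^sup>2"
proof -
  obtain q where q: "q holomorphic_on unit_disk" "q 0 = deriv f 0"
    "\<And>z. f z = z * q z" "\<And>z. norm z < 1 \<Longrightarrow> norm (q z) \<le> A"
    using Schwarz_quotient[OF f(1,2) A] by metis
  \<comment> \<open>\<open>q - 1\<close> vanishes at 0 by the normalization, so a second use of the
    Schwarz lemma yields the second factor \<open>norm z\<close>.\<close>
  have "norm (q z - 1) \<le> (A + 1) * norm z"
  proof (rule Schwarz_le(1)[OF _ _ _ z])
    show "(\<lambda>z. q z - 1) holomorphic_on unit_disk" by (intro holomorphic_intros q)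
    show "norm (q z - 1) \<le> A + 1" if "norm z < 1" for z
      using norm_triangle_ineq4[of "q z" 1] q(4)[OF that] by simp
  qed (use q f in auto)
  moreover have "f z - z = z * (q z - 1)" using q(3)[of z] by (simp add: algebra_simps)
  ultimately show ?thesis
    using mult_left_mono[of "norm (q z - 1)" "(A + 1) * norm z" "norm z"]
    by (simp add: norm_mult power2_eq_square mult_ac)
qed

text \<open>With q = f / z, the function A - q has nonnegative real part and value A - 1 at 0, so
  Harnack makes it small when A is close to 1. For A = 1 the map is the identity.\<close>

lemma norm_diff_id_le:
  assumes f: "f holomorphic_on unit_disk" "f 0 = 0" "deriv f 0 = 1"
    and A: "\<And>z. norm z < 1 \<Longrightarrow> norm (f z) \<le> A" and z: "norm z \<le> r" and r: "r < 1"
  shows "norm (f z - z) \<le> 2 * (A - 1) / (1 - r)" and "A \<ge> 1"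
proof -
  obtain q where q: "q holomorphic_on unit_disk" "q 0 = deriv f 0"
    "\<And>z. f z = z * q z" "\<And>z. norm z < 1 \<Longrightarrow> norm (q z) \<le> A"
    using Schwarz_quotient[OF f(1,2) A] by metis
  show A1: "A \<ge> 1" using Schwarz_le(2)[OF f(1,2) A] f(3) by simp
  have z1: "norm z < 1" using z r by simp
  have "(1 - norm z) * norm (of_real A - q z) \<le> (1 + norm z) * norm (of_real A - q 0)"
  proof (rule Harnack_norm)
    show "(\<lambda>z. of_real A - q z) holomorphic_on unit_disk" by (intro holomorphic_intros q)
    show "0 \<le> Re (of_real A - q z)" if "norm z < 1" for z
      using complex_Re_le_cmod[of "q z"] q(4)[OF that] by simp
  qed (use z1 in auto)
  also have "norm (of_real A - q 0) = A - 1"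
    using A1 q(2) f(3) by (metis norm_of_real abs_of_nonneg diff_ge_0_iff_ge of_real_1 of_real_diff)
  finally have 1: "(1 - norm z) * norm (of_real A - q z) \<le> (1 + norm z) * (A - 1)" .
  have "q z - 1 = (of_real (A - 1)) - (of_real A - q z)" by simp
  then have "norm (q z - 1) \<le> (A - 1) + norm (of_real A - q z)"
    using A1 by (metis norm_triangle_ineq4 norm_of_real abs_of_nonneg diff_ge_0_iff_ge)
  then have "(1 - norm z) * norm (q z - 1) \<le> (1 - norm z) * ((A - 1) + norm (of_real A - q z))"
    using z1 by (intro mult_left_mono) auto
  also have "\<dots> \<le> 2 * (A - 1)" using 1 by (simp add: algebra_simps)
  finally have 2: "(1 - norm z) * norm (q z - 1) \<le> 2 * (A - 1)" .
  have "f z - z = z * (q z - 1)" using q(3)[of z] by (simp add: algebra_simps)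
  then have "norm (f z - z) \<le> norm (q z - 1)"
    using z1 by (simp add: norm_mult mult_left_le_one_le)
  then have "(1 - r) * norm (f z - z) \<le> (1 - norm z) * norm (q z - 1)"
    using z r by (intro mult_mono) auto
  with 2 show "norm (f z - z) \<le> 2 * (A - 1) / (1 - r)"
    using r by (simp add: field_simps)
qed

section \<open>Covering and growth in the class S\<close>

lemma ball_subset_image_of_sphere_bound:
  assumes f: "f holomorphic_on unit_disk" "inj_on f unit_disk" "f 0 = 0"
    and \<rho>: "0 < \<rho>" "\<rho> < 1" and m: "m > 0" "\<And>z. norm z = \<rho> \<Longrightarrow> m \<le> norm (f z)"
  shows "ball 0 m \<subseteq> f ` unit_disk"
proof -
  have sub: "cball 0 \<rho> \<subseteq> (unit_disk::complex set)" "ball 0 \<rho> \<subseteq> (unit_disk::complex set)" using \<rho> by auto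
  \<comment> \<open>Univalence makes the image of the interior open, and the circle is sent outside
    the ball. Since a ball is connected, it cannot leave the image without meeting the image of the
    circle.\<close>
  have "ball (f 0) m \<subseteq> f ` cball 0 \<rho>"
  proof (rule ball_subset_open_map_image)
    show "continuous_on (closure (cball 0 \<rho>)) f"
      using sub f by (auto intro: holomorphic_on_imp_continuous_on holomorphic_on_subset)
    show "open (f ` interior (cball 0 \<rho>))"
      using f sub by (auto intro!: open_mapping_thm3 intro: holomorphic_on_subset inj_on_subset)
    show "m \<le> norm (f z - f 0)" if "z \<in> frontier (cball 0 \<rho>)" for z
      using that m \<rho> f by (simp add: frontier_cball)
  qed (use m \<rho> in auto)
  then show ?thesis using f sub by auto
qed

text \<open>Otherwise the inverse would map a disk of radius 2 into the closed unit disk with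
  derivative 1 at 0, while Cauchy's estimate on radius 3/2 allows at most 2/3.\<close>

lemma class_S_omitted_value:
  assumes "class_S f"
  obtains w where "norm w < 2" "w \<notin> f ` unit_disk"
proof -
  have f: "f holomorphic_on unit_disk" "inj_on f unit_disk" "f 0 = 0" "deriv f 0 = 1"
    using assms by (auto simp: class_S_def)
  have "\<not> ball 0 2 \<subseteq> f ` unit_disk"
  proof
    assume sub: "ball 0 2 \<subseteq> f ` unit_disk"
    obtain g where g: "g holomorphic_on f ` unit_disk"
      "\<And>z. z \<in> unit_disk \<Longrightarrow> deriv f z * deriv g (f z) = 1"
      "\<And>z. z \<in> unit_disk \<Longrightarrow> g (f z) = z"
      using holomorphic_has_inverse[OF f(1) open_ball f(2)] by metis
    have g1: "norm (g w) \<le> 1" if "norm w < 2" for w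
      using sub that g(3) by (auto simp: subset_iff image_iff dest!: spec[of _ w])
    have "cball 0 (3/2) \<subseteq> ball (0::complex) 2" by auto
    then have g': "g holomorphic_on cball 0 (3/2)"
      using holomorphic_on_subset[OF g(1)] sub by blast
    have "norm ((deriv ^^ 1) g 0) \<le> fact 1 * 1 / (3/2) ^ 1"
    proof (rule Cauchy_inequality)
      show "g holomorphic_on ball 0 (3/2)"
        using g' holomorphic_on_subset ball_subset_cball by blast
    qed (use g' g1 in \<open>auto intro: holomorphic_on_imp_continuous_on\<close>)
    moreover have "deriv g 0 = 1" using g(2)[of 0] f by simp
    ultimately show False by simp
  qed
  then show ?thesis using that by (auto simp: subset_iff)
qed

text \<open>If \<open>f\<close> omits \<open>w\<close>, then by univalence the branch \<open>g\<close> of \<open>sqrt (1 - f / w)\<close> with \<open>g 0 = 1\<close> omits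
  both \<open>0\<close> and \<open>-1\<close>, so that Schottky's theorem applies.\<close>

lemma class_S_locally_bounded:
  assumes "0 \<le> r" "r < 1"
  obtains M where "M > 0" "\<And>f z. class_S f \<Longrightarrow> norm z \<le> r \<Longrightarrow> norm (f z) \<le> M"
proof -
  \<comment> \<open>Schottky needs a closed unit disk, hence the rescaling by \<open>t\<close>, and
    then |z / t| \<le> t, that is r \<le> t^2. With this \<open>t\<close> the difference t^2 - r is
    the square of (1 - r) / 2.\<close>
  define t where "t = (1 + r) / 2"
  have t: "0 < t" "t < 1" "r < t" using assms by (auto simp: t_def)
  have rt: "r \<le> t * t"
    using sum_squares_ge_zero[of "1 - r" 0] by (simp add: t_def field_simps)
  define E where "E = exp (pi * exp (pi * (2 + 2 * 1 + 12 * t / (1 - t))))"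
  show thesis
  proof
    show "2 * (1 + E\<^sup>2) > 0" by (simp add: add_pos_nonneg)
    fix f z assume S: "class_S f" and z: "norm (z::complex) \<le> r"
    have f: "f holomorphic_on unit_disk" "inj_on f unit_disk" "f 0 = 0" "deriv f 0 = 1"
      using S by (auto simp: class_S_def)
    obtain w where w: "norm w < 2" "w \<notin> f ` unit_disk"
      using class_S_omitted_value[OF S] by blast
    have w0: "w \<noteq> 0" using w f by force
    obtain g where g: "g holomorphic_on unit_disk"
      "\<And>z. z \<in> unit_disk \<Longrightarrow> 1 - f z / w = (g z)\<^sup>2"
    proof (rule contractible_imp_holomorphic_sqrt[of "\<lambda>z. 1 - f z / w" unit_disk])
      show "(\<lambda>z. 1 - f z / w) holomorphic_on unit_disk" using w0 by (intro holomorphic_intros f)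
      show "contractible (unit_disk::complex set)" by (simp add: convex_imp_contractible)
      show "1 - f z / w \<noteq> 0" if "z \<in> unit_disk" for z using that w w0 by auto
    qed metis
    have g0: "(g 0)\<^sup>2 = 1" using g(2)[of 0] f by simp
    \<comment> \<open>Since \<open>g 0\<close> is 1 or -1, the factor \<open>- g 0\<close> gives
      \<open>h 0 = -1\<close>. Thus the values that \<open>h\<close> omits become 0 and 1:
      \<open>h = 1\<close> would force \<open>f = 0\<close>, hence \<open>z = 0\<close>, where
      \<open>h\<close> is -1.\<close>
    define h where "h = (\<lambda>z. - g 0 * g (of_real t * z))"
    have tz: "of_real t * z \<in> unit_disk" if "norm z \<le> 1" for z :: complex
      using le_less_trans[OF mult_left_mono[OF that, of t]] t by (simp add: norm_mult)
    have h2: "(h z)\<^sup>2 = 1 - f (of_real t * z) / w" if "norm z \<le> 1" for z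
      using g(2)[OF tz[OF that]] g0 by (simp add: h_def power_mult_distrib)
    have hE: "norm (h (z / of_real t)) \<le> E"
      unfolding E_def
    proof (rule Schottky[where f = h and r = 1 and t = t])
      have "(\<lambda>z. g (of_real t * z)) holomorphic_on cball 0 1"
        using holomorphic_on_compose_gen[OF _ g(1), of "\<lambda>z. of_real t * z" "cball 0 1"] tz
        by (force simp: o_def intro!: holomorphic_intros)
      then show "h holomorphic_on cball 0 1"
        unfolding h_def by (intro holomorphic_intros)
      have "(norm (g 0))\<^sup>2 = 1" using g0 by (metis norm_one norm_power)
      then show "norm (h 0) \<le> 1" by (simp add: h_def norm_mult power2_eq_square)
      fix z :: complex assume z: "z \<in> cball 0 1"
      then have fz: "f (of_real t * z) \<noteq> w" using tz w by (auto simp: image_iff)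
      show "\<not> (h z = 0 \<or> h z = 1)"
      proof
        assume "h z = 0 \<or> h z = 1"
        moreover have "h z \<noteq> 0" using h2[of z] z fz w0 by auto
        ultimately have hz: "h z = 1" by blast
        then have "f (of_real t * z) = f 0" using h2[of z] z f w0 by simp
        then have "of_real t * z = 0" using inj_onD[OF f(2) _ tz, of z 0] z by simp
        then have "z = 0" using t by simp
        then show False using hz g0 by (simp add: h_def power2_eq_square)
      qed
    next
      show "norm (z / of_real t) \<le> t" using z rt t by (simp add: norm_divide field_simps)
    qed (use t in auto)
    have "(h (z / of_real t))\<^sup>2 = 1 - f z / w"
      using h2[of "z / of_real t"] z t by (simp add: norm_divide)
    then have "f z = w * (1 - (h (z / of_real t))\<^sup>2)" using w0 by (simp add: field_simps)
    then have "norm (f z) \<le> norm w * (1 + (norm (h (z / of_real t)))\<^sup>2)"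
      using norm_triangle_ineq4[of 1 "(h (z / of_real t))\<^sup>2"]
      by (simp add: norm_mult norm_power mult_left_mono)
    also have "\<dots> \<le> 2 * (1 + E\<^sup>2)"
      using w hE by (intro mult_mono add_mono power_mono) auto
    finally show "norm (f z) \<le> 2 * (1 + E\<^sup>2)" .
  qed
qed

text \<open>Functions of class S may be unbounded on the disk, so the quadratic estimate is applied
  to 2 f(z / 2), which is bounded uniformly over the class.\<close>

lemma class_S_quadratic:
  obtains C where "C > 0"
    "\<And>f z. class_S f \<Longrightarrow> norm z < 1/2 \<Longrightarrow> norm (f z - z) \<le> C * (norm z)\<^sup>2"
proof -
  obtain M where M: "M > 0" "\<And>f z. class_S f \<Longrightarrow> norm z \<le> 1/2 \<Longrightarrow> norm (f z) \<le> M"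
    using class_S_locally_bounded[of "1/2"] by auto
  show thesis
  proof
    show "2 * (2 * M + 1) > 0" using M by simp
    fix f z assume S: "class_S f" and z: "norm (z::complex) < 1/2"
    have f: "f holomorphic_on unit_disk" "f 0 = 0" "deriv f 0 = 1"
      using S by (auto simp: class_S_def)
    define F where "F = (\<lambda>z. 2 * f (z / 2))"
    have half: "(\<lambda>z. z / 2) ` unit_disk \<subseteq> (unit_disk::complex set)"
      by (auto simp: norm_divide)
    have "norm (F (2 * z) - 2 * z) \<le> (2 * M + 1) * (norm (2 * z))\<^sup>2"
    proof (rule norm_diff_id_le_quadratic)
      have "f \<circ> (\<lambda>z. z / 2) holomorphic_on unit_disk"
        using half by (intro holomorphic_on_compose_gen[OF _ f(1)] holomorphic_intros) auto
      then show "F holomorphic_on unit_disk"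
        unfolding F_def by (intro holomorphic_intros) (simp add: o_def)
      have "(f has_field_derivative 1) (at (0 / 2))"
        using holomorphic_derivI[OF f(1), of 0] f by simp
      then have "((\<lambda>z. f (z / 2)) has_field_derivative 1 * (1 / 2)) (at 0)"
        by (rule DERIV_chain2) (auto intro!: derivative_eq_intros)
      then have "(F has_field_derivative 2 * (1 * (1 / 2))) (at 0)"
        unfolding F_def by (rule DERIV_cmult)
      then show "deriv F 0 = 1" by (auto intro: DERIV_imp_deriv)
      show "norm (F z) \<le> 2 * M" if "norm z < 1" for z
        using M(2)[OF S, of "z / 2"] that by (simp add: F_def norm_mult norm_divide)
    qed (use f z in \<open>auto simp: F_def norm_mult\<close>)
    moreover have "F (2 * z) - 2 * z = 2 * (f z - z)" by (simp add: F_def)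
    then have "norm (F (2 * z) - 2 * z) = 2 * norm (f z - z)" by (simp only: norm_mult norm_numeral)
    ultimately show "norm (f z - z) \<le> 2 * (2 * M + 1) * (norm z)\<^sup>2"
      by (simp add: norm_mult power_mult_distrib algebra_simps)
  qed
qed

text \<open>A Koebe covering theorem with an unspecified constant. On the circle of radius
  \<open>\<rho>\<close> the quadratic error is at most half of \<open>\<rho>\<close>, so the image
  of the circle keeps the distance \<open>\<rho> / 2\<close> from 0.\<close>

lemma class_S_covers_ball:
  obtains \<kappa> where "\<kappa> > 0" "\<And>f. class_S f \<Longrightarrow> ball 0 \<kappa> \<subseteq> f ` unit_disk"
proof -
  obtain C where C: "C > 0"
    "\<And>f z. class_S f \<Longrightarrow> norm z < 1/2 \<Longrightarrow> norm (f z - z) \<le> C * (norm z)\<^sup>2"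
    using class_S_quadratic by blast
  define \<rho> where "\<rho> = min (1/4) (1 / (2 * C))"
  have \<rho>: "\<rho> > 0" "\<rho> \<le> 1/4" "C * \<rho> \<le> 1/2"
    using C by (auto simp: \<rho>_def min_def field_simps)
  show thesis
  proof
    show "\<rho> / 2 > 0" using \<rho> by simp
    fix f assume S: "class_S f"
    show "ball 0 (\<rho> / 2) \<subseteq> f ` unit_disk"
    proof (rule ball_subset_image_of_sphere_bound)
      fix z :: complex assume z: "norm z = \<rho>"
      have "norm (f z - z) \<le> (C * \<rho>) * \<rho>"
        using C(2)[OF S, of z] z \<rho> by (simp add: power2_eq_square mult_ac)
      also have "\<dots> \<le> 1/2 * \<rho>" using \<rho> by (intro mult_right_mono) auto
      finally show "\<rho> / 2 \<le> norm (f z)"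
        using norm_triangle_ineq3[of "f z" z] z by linarith
    qed (use S \<rho> in \<open>auto simp: class_S_def\<close>)
  qed
qed

section \<open>Evolution families fixing the origin\<close>

lemma compact_subset_cball:
  fixes K :: "complex set"
  assumes "compact K" "K \<subseteq> unit_disk"
  obtains r where "0 \<le> r" "r < 1" "K \<subseteq> cball 0 r"
proof (cases "K = {}")
  case True
  with that[of 0] show ?thesis by simp
next
  case False
  then obtain x where x: "x \<in> K" "\<And>y. y \<in> K \<Longrightarrow> norm y \<le> norm x"
    using continuous_attains_sup[OF assms(1) False, of norm] by (auto intro: continuous_intros)
  show ?thesis by (rule that[of "norm x"]) (use x assms in auto)
qed

lemma eventually_at_top_obtain:
  fixes T :: real
  assumes "eventually P at_top"
  obtains t where "T \<le> t" "P t"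
proof -
  obtain N where "\<And>t. t \<ge> N \<Longrightarrow> P t"
    using assms by (auto simp: eventually_at_top_linorder)
  then show thesis using that[of "max N T"] by simp
qed

section \<open>Derivatives at the fixed point\<close>

locale radial_evolution =
  fixes \<psi> :: "real \<Rightarrow> real \<Rightarrow> complex \<Rightarrow> complex" and \<beta> :: real
  assumes holo: "0 \<le> s \<Longrightarrow> s \<le> t \<Longrightarrow> \<psi> s t holomorphic_on unit_disk"
    and self: "0 \<le> s \<Longrightarrow> s \<le> t \<Longrightarrow> norm z < 1 \<Longrightarrow> norm (\<psi> s t z) < 1"
    and inj: "0 \<le> s \<Longrightarrow> s \<le> t \<Longrightarrow> inj_on (\<psi> s t) unit_disk"
    and zero [simp]: "0 \<le> s \<Longrightarrow> s \<le> t \<Longrightarrow> \<psi> s t 0 = 0"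
    and comp: "0 \<le> s \<Longrightarrow> s \<le> u \<Longrightarrow> u \<le> t \<Longrightarrow> norm z < 1 \<Longrightarrow> \<psi> u t (\<psi> s u z) = \<psi> s t z"
    and deriv_tendsto: "((\<lambda>t. norm (deriv (\<psi> 0 t) 0)) \<longlongrightarrow> \<beta>) at_top"
begin

text \<open>\<open>b t\<close> stays complex: \<psi> is not rotated to make it positive, since
  division by \<open>b t\<close> absorbs the phase.\<close>

definition b :: "real \<Rightarrow> complex" where "b t = deriv (\<psi> 0 t) 0"

lemma b_nonzero: "0 \<le> t \<Longrightarrow> b t \<noteq> 0"
  unfolding b_def by (rule holomorphic_injective_imp_regular[OF holo _ inj]) auto

lemma deriv_chain_rule:
  assumes st: "0 \<le> s" "s \<le> t" and F: "F holomorphic_on unit_disk"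
    and G: "\<And>z. norm z < 1 \<Longrightarrow> F (\<psi> s t z) = G z"
  shows "deriv F 0 * deriv (\<psi> s t) 0 = deriv G 0"
proof -
  have 1: "(\<psi> s t has_field_derivative deriv (\<psi> s t) 0) (at 0)"
    using holomorphic_derivI[OF holo[OF st], of 0] by simp
  have 2: "(F has_field_derivative deriv F 0) (at (\<psi> s t 0))"
    using holomorphic_derivI[OF F, of 0] st by simp
  have "((\<lambda>z. F (\<psi> s t z)) has_field_derivative deriv F 0 * deriv (\<psi> s t) 0) (at 0)"
    by (rule DERIV_chain2[OF 2 1])
  then have "(G has_field_derivative deriv F 0 * deriv (\<psi> s t) 0) (at 0)"
    by (rule has_field_derivative_transform_within_open[of _ _ _ unit_disk]) (use G in auto)
  then show ?thesis by (simp add: DERIV_imp_deriv)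
qed

lemma deriv_psi:
  assumes "0 \<le> s" "s \<le> t"
  shows "deriv (\<psi> s t) 0 = b t / b s"
  using deriv_chain_rule[of 0 s "\<psi> s t" "\<psi> 0 t"] assms b_nonzero[of s] holo comp
  by (simp add: b_def field_simps)

lemma norm_psi_le: "0 \<le> s \<Longrightarrow> s \<le> t \<Longrightarrow> norm z < 1 \<Longrightarrow> norm (\<psi> s t z) \<le> norm z"
  using Schwarz_Lemma(1)[OF holo zero self] by blast

lemma norm_b_antimono:
  assumes "0 \<le> s" "s \<le> t"
  shows "norm (b t) \<le> norm (b s)"
  using Schwarz_Lemma(2)[OF holo zero self, of s t 0] assms b_nonzero[of s]
  by (simp add: deriv_psi norm_divide)

lemma norm_b_tendsto: "((\<lambda>t. norm (b t)) \<longlongrightarrow> \<beta>) at_top"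
  using deriv_tendsto by (simp add: b_def)

lemma beta_le_norm_b: "0 \<le> t \<Longrightarrow> \<beta> \<le> norm (b t)"
  by (rule tendsto_upperbound[OF norm_b_tendsto])
     (auto intro: eventually_mono[OF eventually_ge_at_top[of t]] norm_b_antimono)

lemma beta_nonneg: "0 \<le> \<beta>"
  by (rule tendsto_lowerbound[OF norm_b_tendsto]) auto

section \<open>Transition maps and chains as members of the class S\<close>

lemma class_S_psi:
  assumes "0 \<le> s" "s \<le> t"
  shows "class_S (\<lambda>z. b s / b t * \<psi> s t z)"
proof -
  have "b s / b t \<noteq> 0" using b_nonzero assms by simp
  moreover have "((\<lambda>z. b s / b t * \<psi> s t z) has_field_derivative b s / b t * (b t / b s)) (at 0)"
    using holomorphic_derivI[OF holo[OF assms], of 0] deriv_psi[OF assms] by (intro DERIV_cmult) simp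
  then have "deriv (\<lambda>z. b s / b t * \<psi> s t z) 0 = 1"
    using b_nonzero assms by (simp add: DERIV_imp_deriv)
  ultimately show ?thesis
    using holo[OF assms] inj[OF assms] assms
    by (auto simp: class_S_def inj_on_def intro!: holomorphic_intros)
qed

text \<open>Loewner chains for \<psi> without regularity in time. Regularity is recovered from the
  displacement estimate after the return to \<phi>.\<close>

definition radial_chain :: "(real \<Rightarrow> complex \<Rightarrow> complex) \<Rightarrow> bool" where
  "radial_chain F \<longleftrightarrow>
     (\<forall>t\<ge>0. F t holomorphic_on unit_disk \<and> inj_on (F t) unit_disk) \<and>
     (\<forall>s t z. 0 \<le> s \<and> s \<le> t \<and> norm z < 1 \<longrightarrow> F t (\<psi> s t z) = F s z) \<and>
     F 0 0 = 0 \<and> deriv (F 0) 0 = 1"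

lemma radial_chainD:
  assumes "radial_chain F"
  shows "0 \<le> t \<Longrightarrow> F t holomorphic_on unit_disk" "0 \<le> t \<Longrightarrow> inj_on (F t) unit_disk"
    "0 \<le> s \<Longrightarrow> s \<le> t \<Longrightarrow> norm z < 1 \<Longrightarrow> F t (\<psi> s t z) = F s z"
    "0 \<le> t \<Longrightarrow> F t 0 = 0" "deriv (F 0) 0 = 1"
proof -
  show 1: "0 \<le> s \<Longrightarrow> s \<le> t \<Longrightarrow> norm z < 1 \<Longrightarrow> F t (\<psi> s t z) = F s z" for s t z
    using assms by (auto simp: radial_chain_def)
  show "F t 0 = 0" if "0 \<le> t"
    using 1[of 0 t 0] that assms by (simp add: radial_chain_def)
qed (use assms in \<open>auto simp: radial_chain_def\<close>)

lemma radial_chain_class_S: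
  assumes F: "radial_chain F" and t: "0 \<le> t"
  shows "class_S (\<lambda>z. b t * F t z)"
proof -
  note FD = radial_chainD[OF F]
  have "deriv (F t) 0 * b t = 1"
    using deriv_chain_rule[of 0 t "F t" "F 0"] t FD by (simp add: b_def)
  moreover have "((\<lambda>z. b t * F t z) has_field_derivative b t * deriv (F t) 0) (at 0)"
    using holomorphic_derivI[OF FD(1)[OF t], of 0] by (intro DERIV_cmult) simp
  ultimately have "deriv (\<lambda>z. b t * F t z) 0 = 1"
    by (simp add: DERIV_imp_deriv mult.commute)
  then show ?thesis
    using FD(1,2,4)[OF t] b_nonzero[OF t]
    by (auto simp: class_S_def inj_on_def intro!: holomorphic_intros)
qed

text \<open>By \<open>class_S_psi\<close>, \<psi> s t z is O(|b t|) uniformly on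
  \<open>norm z \<le> r\<close>, so replacing G w by w there costs O(|b t|^2). The estimate is
  uniform in \<open>G\<close> because it has two uses: normalized transition maps give the Cauchy
  property, and \<open>b t * F t\<close> for an arbitrary chain gives uniqueness.\<close>

lemma eventually_class_S_close:
  assumes "\<beta> = 0" "0 \<le> s" "0 \<le> r" "r < 1" "\<epsilon> > 0"
  shows "\<forall>\<^sub>F t in at_top. \<forall>G z. class_S G \<longrightarrow> norm z \<le> r \<longrightarrow>
           norm (G (\<psi> s t z) / b t - \<psi> s t z / b t) < \<epsilon>"
proof -
  obtain C where C: "C > 0"
    "\<And>f z. class_S f \<Longrightarrow> norm z < 1/2 \<Longrightarrow> norm (f z - z) \<le> C * (norm z)\<^sup>2"
    using class_S_quadratic by blast
  obtain M where M: "M > 0" "\<And>f z. class_S f \<Longrightarrow> norm z \<le> r \<Longrightarrow> norm (f z) \<le> M"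
    using class_S_locally_bounded assms by metis
  define B where "B = M / norm (b s)"
  have lim: "((\<lambda>t. B * norm (b t)) \<longlongrightarrow> B * \<beta>) at_top" "((\<lambda>t. C * B\<^sup>2 * norm (b t)) \<longlongrightarrow> C * B\<^sup>2 * \<beta>) at_top"
    by (intro tendsto_intros norm_b_tendsto)+
  have "\<forall>\<^sub>F t in at_top. B * norm (b t) < 1/2" "\<forall>\<^sub>F t in at_top. C * B\<^sup>2 * norm (b t) < \<epsilon>"
    using order_tendstoD(2)[OF lim(1), of "1/2"] order_tendstoD(2)[OF lim(2), of \<epsilon>] assms(1,5)
    by simp_all
  then show ?thesis
    using eventually_ge_at_top[of s]
  proof eventually_elim
    case (elim t)
    have bt: "b t \<noteq> 0" "b s \<noteq> 0" using b_nonzero elim assms by auto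
    show ?case
    proof (intro allI impI)
      fix G and z :: complex assume G: "class_S G" and z: "norm z \<le> r"
      let ?w = "\<psi> s t z"
      have "norm (b s / b t * ?w) \<le> M"
        using M(2)[OF class_S_psi z] elim assms by simp
      then have w: "norm ?w \<le> B * norm (b t)"
        using bt by (simp add: B_def norm_mult norm_divide field_simps)
      then have "norm (G ?w - ?w) \<le> C * (norm ?w)\<^sup>2"
        using elim by (intro C(2)[OF G]) simp
      also have "\<dots> \<le> C * (B * norm (b t))\<^sup>2"
        using w C by (intro mult_left_mono power_mono) auto
      also have "\<dots> = C * B\<^sup>2 * norm (b t) * norm (b t)"
        by (simp add: power2_eq_square)
      also have "\<dots> < \<epsilon> * norm (b t)"
        using elim bt by (intro mult_strict_right_mono) auto
      finally show "norm (G ?w / b t - ?w / b t) < \<epsilon>"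
        using bt by (simp add: norm_divide pos_divide_less_eq flip: diff_divide_distrib)
    qed
  qed
qed

text \<open>In both cases the later approximant is \<open>G (\<psi> s t z) / b t\<close> with
  \<open>G\<close> the normalized transition map from t to t'. For \<beta> > 0, |b t'| \<ge> \<beta>
  bounds \<open>G\<close> by |b t| / \<beta>, and \<open>norm_diff_id_le\<close> applies.\<close>

lemma eventually_Cauchy:
  assumes "0 \<le> s" "0 \<le> r" "r < 1" "\<epsilon> > 0"
  shows "\<forall>\<^sub>F t in at_top. \<forall>t'\<ge>t. \<forall>z. norm z \<le> r \<longrightarrow> norm (\<psi> s t' z / b t' - \<psi> s t z / b t) < \<epsilon>"
proof (cases "\<beta> = 0")
  case True
  show ?thesis
    using eventually_class_S_close[OF True assms] eventually_ge_at_top[of s]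
  proof eventually_elim
    case (elim t)
    show ?case
    proof (intro allI impI)
      fix t' and z :: complex assume t': "t \<le> t'" and z: "norm z \<le> r"
      have "b t \<noteq> 0" using b_nonzero elim assms by auto
      then show "norm (\<psi> s t' z / b t' - \<psi> s t z / b t) < \<epsilon>"
        using elim(1)[rule_format, OF class_S_psi[of t t'] z] elim(2) t' assms z
        by (simp add: comp)
    qed
  qed
next
  case False
  then have \<beta>: "\<beta> > 0" using beta_nonneg by simp
  have "((\<lambda>t. 2 * (norm (b t) / \<beta> - 1) / (1 - r) / \<beta>) \<longlongrightarrow> 2 * (\<beta> / \<beta> - 1) / (1 - r) / \<beta>) at_top"
    by (intro tendsto_intros norm_b_tendsto) (use \<beta> assms in auto)
  then have "\<forall>\<^sub>F t in at_top. 2 * (norm (b t) / \<beta> - 1) / (1 - r) / \<beta> < \<epsilon>"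
    using \<beta> assms by (auto dest: order_tendstoD)
  then show ?thesis
    using eventually_ge_at_top[of s]
  proof eventually_elim
    case (elim t)
    have t: "0 \<le> t" using elim assms by simp
    show ?case
    proof (intro allI impI)
      fix t' and z :: complex assume t': "t \<le> t'" and z: "norm z \<le> r"
      let ?w = "\<psi> s t z" and ?G = "\<lambda>z. b t / b t' * \<psi> t t' z"
      have bt: "b t \<noteq> 0" "b t' \<noteq> 0" using b_nonzero t t' by auto
      have S: "class_S ?G" using class_S_psi t t' by simp
      have w: "norm ?w \<le> r" using norm_psi_le[of s t z] assms z elim by simp
      have "norm (?G ?w - ?w) \<le> 2 * (norm (b t) / \<beta> - 1) / (1 - r)"
      proof (rule norm_diff_id_le(1)[OF _ _ _ _ w])
        show "norm (?G \<zeta>) \<le> norm (b t) / \<beta>" if "norm \<zeta> < 1" for \<zeta>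
        proof -
          have "norm (?G \<zeta>) \<le> norm (b t) / norm (b t') * 1"
            unfolding norm_mult norm_divide
            using self[of t t' \<zeta>] that t t' by (intro mult_left_mono) auto
          also have "\<dots> \<le> norm (b t) / \<beta>"
            using beta_le_norm_b[of t'] t t' \<beta> by (simp add: frac_le)
          finally show ?thesis .
        qed
      qed (use S assms in \<open>auto simp: class_S_def\<close>)
      moreover have "?G ?w - ?w = b t * (\<psi> s t' z / b t' - ?w / b t)"
        using bt comp[of s t t' z] assms z elim t' by (simp add: field_simps)
      ultimately have *: "norm (b t) * norm (\<psi> s t' z / b t' - ?w / b t) \<le> 2 * (norm (b t) / \<beta> - 1) / (1 - r)"
        by (simp add: norm_mult)
      have "\<beta> * norm (\<psi> s t' z / b t' - ?w / b t) \<le> norm (b t) * norm (\<psi> s t' z / b t' - ?w / b t)"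
        using beta_le_norm_b[OF t] by (intro mult_right_mono) auto
      with * have "\<beta> * norm (\<psi> s t' z / b t' - ?w / b t) \<le> 2 * (norm (b t) / \<beta> - 1) / (1 - r)"
        by linarith
      then have "norm (\<psi> s t' z / b t' - ?w / b t) \<le> 2 * (norm (b t) / \<beta> - 1) / (1 - r) / \<beta>"
        by (subst pos_le_divide_eq[OF \<beta>]) (simp only: mult.commute)
      with elim show "norm (\<psi> s t' z / b t' - ?w / b t) < \<epsilon>" by simp
    qed
  qed
qed

text \<open>Integer times give a sequence, as the theorems on uniform limits and Hurwitz's theorem
  require; \<open>max s\<close> keeps the end time at or after \<open>s\<close>.\<close>

definition approx :: "real \<Rightarrow> nat \<Rightarrow> complex \<Rightarrow> complex" where
  "approx s n z = \<psi> s (max s (real n)) z / b (max s (real n))"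

definition limit_chain :: "real \<Rightarrow> complex \<Rightarrow> complex" where
  "limit_chain s z = lim (\<lambda>n. approx s n z)"

lemma uniform_limit_cball:
  assumes s: "0 \<le> s" and r: "0 \<le> r" "r < 1"
  shows "uniform_limit (cball 0 r) (approx s) (limit_chain s) sequentially"
proof -
  have "uniformly_convergent_on (cball 0 r) (approx s)"
  proof (rule Cauchy_uniformly_convergent, rule uniformly_Cauchy_onI')
    fix \<epsilon> :: real assume "\<epsilon> > 0"
    from eventually_Cauchy[OF s r this] obtain T where
      T: "\<And>t t' z. T \<le> t \<Longrightarrow> t \<le> t' \<Longrightarrow> norm z \<le> r \<Longrightarrow> norm (\<psi> s t' z / b t' - \<psi> s t z / b t) < \<epsilon>"
      by (auto simp: eventually_at_top_linorder)
    have "dist (approx s m z) (approx s n z) < \<epsilon>"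
      if "z \<in> cball 0 r" "nat \<lceil>T\<rceil> \<le> m" "m < n" for z m n
    proof -
      have "T \<le> max s (real m)" using that by linarith
      then show ?thesis
        using T[of "max s (real m)" "max s (real n)" z] that
        by (simp add: approx_def dist_norm norm_minus_commute)
    qed
    then show "\<exists>M. \<forall>z\<in>cball 0 r. \<forall>m\<ge>M. \<forall>n>m. dist (approx s m z) (approx s n z) < \<epsilon>"
      by blast
  qed
  then show ?thesis
    unfolding uniformly_convergent_uniform_limit_iff limit_chain_def .
qed

lemma approx_tendsto:
  assumes "0 \<le> s" "norm z < 1"
  shows "(\<lambda>n. approx s n z) \<longlonglongrightarrow> limit_chain s z"
  by (rule tendsto_uniform_limitI[OF uniform_limit_cball[OF assms(1) norm_ge_zero assms(2)]]) simp

lemma approx_holomorphic: "0 \<le> s \<Longrightarrow> approx s n holomorphic_on unit_disk"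
  unfolding approx_def using b_nonzero by (intro holomorphic_intros holo) auto

lemma deriv_approx:
  assumes "0 \<le> s"
  shows "deriv (approx s n) 0 = 1 / b s"
proof -
  let ?T = "max s (real n)"
  have "(\<psi> s ?T has_field_derivative b ?T / b s) (at 0)"
    using holomorphic_derivI[OF holo, of s ?T 0] deriv_psi[of s ?T] assms by simp
  then have "(approx s n has_field_derivative b ?T / b s / b ?T) (at 0)"
    unfolding approx_def by (rule DERIV_cdivide)
  then show ?thesis using b_nonzero[of ?T] assms by (simp add: DERIV_imp_deriv)
qed

section \<open>The limit is a chain\<close>

lemma limit_chain_holomorphic:
  assumes s: "0 \<le> s"
  shows "limit_chain s holomorphic_on unit_disk"
proof (rule holomorphic_uniform_sequence[OF _ approx_holomorphic[OF s]])
  fix x :: complex assume x: "x \<in> unit_disk"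
  define d where "d = (1 - norm x) / 2"
  have d: "d > 0" "norm x + d < 1" using x by (auto simp: d_def field_simps)
  have sub: "cball x d \<subseteq> cball 0 (norm x + d)"
    by (simp add: cball_subset_cball_iff)
  show "\<exists>d>0. cball x d \<subseteq> unit_disk \<and> uniform_limit (cball x d) (approx s) (limit_chain s) sequentially"
    using d sub uniform_limit_on_subset[OF uniform_limit_cball[OF s, of "norm x + d"] sub]
    by (intro exI[of _ d]) force
qed simp

lemma deriv_limit_chain:
  assumes s: "0 \<le> s"
  shows "deriv (limit_chain s) 0 = 1 / b s"
proof -
  have "uniform_limit (ball 0 (1/2)) (approx s) (limit_chain s) sequentially"
    by (rule uniform_limit_on_subset[OF uniform_limit_cball[OF s, of "1/2"]]) auto
  then have "(\<lambda>n. (deriv ^^ 1) (approx s n) 0) \<longlonglongrightarrow> (deriv ^^ 1) (limit_chain s) 0"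
    by (rule higher_deriv_complex_uniform_limit)
       (auto intro!: always_eventually holomorphic_on_subset[OF approx_holomorphic[OF s]])
  then have "(\<lambda>n::nat. 1 / b s) \<longlonglongrightarrow> deriv (limit_chain s) 0"
    by (simp add: deriv_approx[OF s])
  then show ?thesis by (simp add: LIMSEQ_const_iff)
qed

lemma limit_chain_inj:
  assumes s: "0 \<le> s"
  shows "inj_on (limit_chain s) unit_disk"
proof (rule Hurwitz_injective[OF _ _ approx_holomorphic[OF s] limit_chain_holomorphic[OF s]])
  show "uniform_limit K (approx s) (limit_chain s) sequentially" if "compact K" "K \<subseteq> unit_disk" for K
    using compact_subset_cball[OF that] uniform_limit_on_subset[OF uniform_limit_cball[OF s]] by metis
  show "inj_on (approx s n) unit_disk" for n
    using inj[of s "max s (real n)"] b_nonzero[of "max s (real n)"] s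
    by (auto simp: inj_on_def approx_def)
  \<comment> \<open>The derivative at 0 is the same for all approximants, so the limit inherits the
    nonzero value \<open>1 / b s\<close>.\<close>
  show "\<not> limit_chain s constant_on unit_disk"
  proof
    assume "limit_chain s constant_on unit_disk"
    then obtain c where c: "\<And>z. z \<in> unit_disk \<Longrightarrow> limit_chain s z = c"
      by (auto simp: constant_on_def)
    have "(limit_chain s has_field_derivative 0) (at 0)"
      by (rule has_field_derivative_transform_within_open[of "\<lambda>_. c" _ _ unit_disk]) (use c in auto)
    then show False
      using deriv_limit_chain[OF s] b_nonzero[OF s] DERIV_imp_deriv by fastforce
  qed
qed auto

lemma limit_chain_comp:
  assumes st: "0 \<le> s" "s \<le> t" and z: "norm z < 1"
  shows "limit_chain t (\<psi> s t z) = limit_chain s z"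
proof -
  \<comment> \<open>Once n is at least \<open>t\<close>, both approximants end at the same time and
    the relation is exact before the limit.\<close>
  have "eventually (\<lambda>n. approx t n (\<psi> s t z) = approx s n z) sequentially"
    using eventually_ge_at_top[of "nat \<lceil>t\<rceil>"]
  proof eventually_elim
    case (elim n)
    then have "max t (real n) = real n" "max s (real n) = real n" "t \<le> real n"
      using st by linarith+
    then show ?case using st z by (simp add: approx_def comp)
  qed
  moreover have "(\<lambda>n. approx t n (\<psi> s t z)) \<longlonglongrightarrow> limit_chain t (\<psi> s t z)"
    using st z self by (intro approx_tendsto) auto
  ultimately have "(\<lambda>n. approx s n z) \<longlonglongrightarrow> limit_chain t (\<psi> s t z)"
    by (rule Lim_transform_eventually[rotated])
  then show ?thesis using approx_tendsto[OF st(1) z] LIMSEQ_unique by blast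
qed

lemma radial_chain_limit_chain: "radial_chain limit_chain"
proof -
  have "approx 0 n 0 = 0" for n by (simp add: approx_def)
  then have "limit_chain 0 0 = 0"
    using approx_tendsto[of 0 0] by (simp add: LIMSEQ_const_iff)
  moreover have "b 0 = 1"
  proof -
    \<comment> \<open>The locale does not state that \<psi> 0 0 is the identity; its derivative is a
      nonzero idempotent by the composition law.\<close>
    have "b 0 * b 0 = b 0"
      using deriv_chain_rule[of 0 0 "\<psi> 0 0" "\<psi> 0 0"] holo comp by (simp add: b_def)
    then show ?thesis using b_nonzero[of 0] by simp
  qed
  ultimately show ?thesis
    unfolding radial_chain_def
    using limit_chain_holomorphic limit_chain_inj limit_chain_comp deriv_limit_chain[of 0] by auto
qed

section \<open>The union of the ranges\<close>

lemma limit_chain_range_zero: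
  assumes "\<beta> = 0"
  shows "(\<Union>t\<in>{0..}. limit_chain t ` unit_disk) = UNIV"
proof -
  obtain \<kappa> where \<kappa>: "\<kappa> > 0" "\<And>f. class_S f \<Longrightarrow> ball 0 \<kappa> \<subseteq> f ` unit_disk"
    using class_S_covers_ball by blast
  have "w \<in> (\<Union>t\<in>{0..}. limit_chain t ` unit_disk)" for w
  proof -
    have "((\<lambda>t. norm (b t) * norm w) \<longlongrightarrow> \<beta> * norm w) at_top"
      by (intro tendsto_intros norm_b_tendsto)
    then have "\<forall>\<^sub>F t in at_top. norm (b t) * norm w < \<kappa>"
      using \<kappa> assms by (auto dest: order_tendstoD)
    \<comment> \<open>The normalized map \<open>b t * limit_chain t\<close> covers the ball of
      radius \<open>\<kappa>\<close>, so \<open>limit_chain t\<close> covers radius \<kappa> / |b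
      t|, which is unbounded in t.\<close>
    then obtain t where t: "0 \<le> t" "norm (b t) * norm w < \<kappa>"
      by (rule eventually_at_top_obtain)
    then have "b t * w \<in> (\<lambda>z. b t * limit_chain t z) ` unit_disk"
      using \<kappa>(2)[OF radial_chain_class_S[OF radial_chain_limit_chain t(1)]] by (auto simp: norm_mult)
    then have "w \<in> limit_chain t ` unit_disk" using b_nonzero[OF t(1)] by auto
    then show ?thesis using t(1) by blast
  qed
  then show ?thesis by blast
qed

lemma norm_limit_chain_le:
  assumes \<beta>: "\<beta> > 0" and tz: "0 \<le> t" "norm z < 1"
  shows "norm (limit_chain t z) \<le> 1 / \<beta>"
proof (rule tendsto_upperbound[OF tendsto_norm[OF approx_tendsto[OF tz]]])
  have "norm (approx t n z) \<le> 1 / \<beta>" for n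
    unfolding approx_def norm_divide
    using self[of t "max t (real n)" z] beta_le_norm_b[of "max t (real n)"] tz \<beta>
    by (intro frac_le) auto
  then show "\<forall>\<^sub>F n in sequentially. norm (approx t n z) \<le> 1 / \<beta>" by simp
qed simp

lemma limit_chain_range_pos:
  assumes \<beta>: "\<beta> > 0"
  shows "(\<Union>t\<in>{0..}. limit_chain t ` unit_disk) = ball 0 (1 / \<beta>)"
proof (intro equalityI subsetI)
  fix w assume "w \<in> (\<Union>t\<in>{0..}. limit_chain t ` unit_disk)"
  then obtain t where t: "0 \<le> t" "w \<in> limit_chain t ` unit_disk" by auto
  \<comment> \<open>The limit only gives a non-strict bound; openness of the range excludes the
    boundary circle.\<close>
  have "open (limit_chain t ` unit_disk)"
    using limit_chain_holomorphic limit_chain_inj t by (intro open_mapping_thm3) auto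
  moreover have "limit_chain t ` unit_disk \<subseteq> cball 0 (1 / \<beta>)" using norm_limit_chain_le[OF \<beta>] t by auto
  ultimately have "limit_chain t ` unit_disk \<subseteq> interior (cball 0 (1 / \<beta>))"
    by (rule interior_maximal[rotated])
  then show "w \<in> ball 0 (1 / \<beta>)" using t by auto
next
  fix w :: complex assume "w \<in> ball 0 (1 / \<beta>)"
  then have w: "\<beta> * norm w < 1" using \<beta> by (simp add: field_simps)
  obtain \<rho> where \<rho>: "\<beta> * norm w < \<rho>" "\<rho> < 1" using dense[OF w] by blast
  have \<rho>0: "\<rho> > 0" using \<rho> \<beta> by (smt (verit) mult_nonneg_nonneg norm_ge_zero)
  \<comment> \<open>\<open>m t\<close> is a lower bound for |b t * limit_chain t| on the circle of
    radius \<open>\<rho>\<close>. It tends to \<open>\<rho>\<close>, whereas |b t| |w| tends to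
    \<beta> |w| < \<rho>.\<close>
  define m where "m = (\<lambda>t. \<rho> - 2 * (norm (b t) / \<beta> - 1) / (1 - \<rho>))"
  have "((\<lambda>t. m t - norm (b t) * norm w) \<longlongrightarrow> (\<rho> - 2 * (\<beta> / \<beta> - 1) / (1 - \<rho>)) - \<beta> * norm w) at_top"
    unfolding m_def by (intro tendsto_intros norm_b_tendsto) (use \<beta> \<rho> in auto)
  then have "\<forall>\<^sub>F t in at_top. 0 < m t - norm (b t) * norm w"
    by (rule order_tendstoD(1)) (use \<beta> \<rho> in simp)
  then obtain t where "0 \<le> t" "0 < m t - norm (b t) * norm w"
    by (rule eventually_at_top_obtain)
  then have t: "norm (b t) * norm w < m t" "0 \<le> t" by auto
  let ?G = "\<lambda>z. b t * limit_chain t z"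
  have S: "class_S ?G" by (rule radial_chain_class_S[OF radial_chain_limit_chain t(2)])
  have "ball 0 (m t) \<subseteq> ?G ` unit_disk"
  proof (rule ball_subset_image_of_sphere_bound[OF _ _ _ \<rho>0 \<rho>(2)])
    show "m t > 0" using t by (smt (verit) mult_nonneg_nonneg norm_ge_zero)
    fix z :: complex assume z: "norm z = \<rho>"
    have "norm (?G z - z) \<le> 2 * (norm (b t) / \<beta> - 1) / (1 - \<rho>)"
    proof (rule norm_diff_id_le(1))
      show "norm (?G z) \<le> norm (b t) / \<beta>" if "norm z < 1" for z
        unfolding norm_mult using norm_limit_chain_le[OF \<beta> t(2) that] mult_left_mono[of _ "1 / \<beta>" "norm (b t)"] by simp
    qed (use S z \<rho> in \<open>auto simp: class_S_def\<close>)
    then show "m t \<le> norm (?G z)"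
      using norm_triangle_ineq3[of "?G z" z] z unfolding m_def by linarith
  qed (use S in \<open>auto simp: class_S_def\<close>)
  moreover have "b t * w \<in> ball 0 (m t)" using t by (simp add: norm_mult)
  ultimately have "b t * w \<in> ?G ` unit_disk" by blast
  then have "w \<in> limit_chain t ` unit_disk" using b_nonzero[OF t(2)] by auto
  then show "w \<in> (\<Union>t\<in>{0..}. limit_chain t ` unit_disk)"
    using t(2) by blast
qed

lemma limit_chain_range:
  "(\<Union>t\<in>{0..}. limit_chain t ` unit_disk) = (if \<beta> = 0 then UNIV else ball 0 (1 / \<beta>))"
  using limit_chain_range_zero limit_chain_range_pos beta_nonneg by auto

section \<open>Comparison of two chains\<close>

lemma radial_chain_unique_zero:
  assumes "\<beta> = 0" "radial_chain F" "radial_chain G" "0 \<le> s" "norm z < 1"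
  shows "F s z = G s z"
proof -
  have "norm (F s z - G s z) \<le> 0 + 2 * \<epsilon>" if \<epsilon>: "\<epsilon> > 0" for \<epsilon>
  proof -
    obtain t where t: "s \<le> t" and "\<forall>G \<zeta>. class_S G \<longrightarrow> norm \<zeta> \<le> norm z \<longrightarrow>
           norm (G (\<psi> s t \<zeta>) / b t - \<psi> s t \<zeta> / b t) < \<epsilon>"
      using eventually_class_S_close[OF assms(1,4) norm_ge_zero assms(5) \<epsilon>]
      by (rule eventually_at_top_obtain)
    then have close: "norm (G (\<psi> s t z) / b t - \<psi> s t z / b t) < \<epsilon>" if "class_S G" for G
      using that by blast
    \<comment> \<open>The approximant \<open>\<psi> s t z / b t\<close> does not depend on the
      chain, so all chains are close to the same point.\<close>
    have *: "norm (H s z - \<psi> s t z / b t) < \<epsilon>" if "radial_chain H" for H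
    proof -
      have "H t (\<psi> s t z) = H s z" "b t \<noteq> 0" "0 \<le> t"
        using radial_chainD(3)[OF that] t assms(4,5) b_nonzero[of t] by auto
      then show ?thesis using close[OF radial_chain_class_S[OF that, of t]] by simp
    qed
    show ?thesis
      using *[OF assms(2)] *[OF assms(3)] norm_triangle_ineq4[of "F s z - \<psi> s t z / b t" "G s z - \<psi> s t z / b t"]
      by simp
  qed
  then have "norm (F s z - G s z) \<le> 0" by (rule le_mult_epsI)
  then show ?thesis by simp
qed

lemma radial_chain_mono:
  assumes "radial_chain F" "0 \<le> s" "s \<le> t"
  shows "F s ` unit_disk \<subseteq> F t ` unit_disk"
proof (rule image_subsetI)
  fix z :: complex assume "z \<in> unit_disk"
  then show "F s z \<in> F t ` unit_disk"
    using radial_chainD(3)[OF assms, of z] self[OF assms(2,3), of z]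
    by (intro image_eqI[of _ _ "\<psi> s t z"]) auto
qed

text \<open>On the range of \<open>F t\<close> the map is \<open>G t\<close> composed with the
  inverse of \<open>F t\<close>. The common relation with \<psi> makes these maps agree for
  different t; since the ranges are open and increasing, holomorphy and injectivity pass to the
  union.\<close>

lemma radial_chain_transition:
  assumes F: "radial_chain F" and G: "radial_chain G"
  obtains H where "H holomorphic_on (\<Union>t\<in>{0..}. F t ` unit_disk)"
    "inj_on H (\<Union>t\<in>{0..}. F t ` unit_disk)" "H 0 = 0" "deriv H 0 = 1"
    "\<And>t z. 0 \<le> t \<Longrightarrow> norm z < 1 \<Longrightarrow> H (F t z) = G t z"
proof -
  note FD = radial_chainD[OF F] and GD = radial_chainD[OF G]
  have wd: "G s z = G t z'" if st: "0 \<le> s" "s \<le> t" "norm z < 1" "norm z' < 1" "F s z = F t z'" for s t z z'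
  proof -
    have "F t (\<psi> s t z) = F t z'" using FD(3)[OF st(1-3)] st(5) by simp
    then have "\<psi> s t z = z'"
      using FD(2)[of t] st self[OF st(1-3)] by (auto simp: inj_on_def)
    then show ?thesis using GD(3)[OF st(1-3)] by simp
  qed
  define H where "H = (\<lambda>w. SOME v. \<exists>t z. 0 \<le> t \<and> norm z < 1 \<and> F t z = w \<and> G t z = v)"
  have H: "H (F t z) = G t z" if "0 \<le> t" "norm z < 1" for t z
  proof -
    have "\<exists>v t' z'. 0 \<le> t' \<and> norm z' < 1 \<and> F t' z' = F t z \<and> G t' z' = v"
      using that by blast
    then have "\<exists>t' z'. 0 \<le> t' \<and> norm z' < 1 \<and> F t' z' = F t z \<and> G t' z' = H (F t z)"
      unfolding H_def by (rule someI_ex)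
    then obtain t' z' where *: "0 \<le> t'" "norm z' < 1" "F t' z' = F t z" "G t' z' = H (F t z)"
      by blast
    show ?thesis
      using wd[of t' t z' z] wd[of t t' z z'] * that by (cases "t \<le> t'") auto
  qed
  have FDopen: "open (F t ` unit_disk)" if "0 \<le> t" for t
    using FD(1,2)[OF that] by (intro open_mapping_thm3) auto
  have Hholo: "H holomorphic_on (\<Union>t\<in>{0..}. F t ` unit_disk)"
  proof (rule holomorphic_on_UN_open)
    fix t :: real assume "t \<in> {0..}"
    then have t: "0 \<le> t" by simp
    obtain g where g: "g holomorphic_on F t ` unit_disk" "\<And>z. z \<in> unit_disk \<Longrightarrow> g (F t z) = z"
      using holomorphic_has_inverse[OF FD(1)[OF t] open_ball FD(2)[OF t]] by metis
    have "G t \<circ> g holomorphic_on F t ` unit_disk"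
      using g GD(1)[OF t] by (intro holomorphic_on_compose_gen[OF g(1)]) auto
    then show "H holomorphic_on F t ` unit_disk"
      by (rule holomorphic_transform) (use g H t in auto)
    show "open (F t ` unit_disk)" by (rule FDopen[OF t])
  qed
  have "inj_on H (\<Union>t\<in>{0..}. F t ` unit_disk)"
  proof (rule inj_onI)
    fix x y assume "x \<in> (\<Union>t\<in>{0..}. F t ` unit_disk)" "y \<in> (\<Union>t\<in>{0..}. F t ` unit_disk)" and eq: "H x = H y"
    then obtain s t where st: "0 \<le> s" "x \<in> F s ` unit_disk" "0 \<le> t" "y \<in> F t ` unit_disk" by auto
    define u where "u = max s t"
    have "x \<in> F u ` unit_disk" "y \<in> F u ` unit_disk"
      using radial_chain_mono[OF F st(1), of u] radial_chain_mono[OF F st(3), of u] st by (auto simp: u_def)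
    then obtain z z' where z: "norm z < 1" "norm z' < 1" "x = F u z" "y = F u z'" by auto
    have u: "0 \<le> u" using st by (simp add: u_def)
    have "G u z = G u z'" using eq H[OF u] z by simp
    then show "x = y" using inj_onD[OF GD(2)[OF u], of z z'] z by simp
  qed
  moreover have "H 0 = 0" using H[of 0 0] FD(4)[of 0] GD(4)[of 0] by simp
  moreover have "deriv H 0 = 1"
  proof -
    have 0: "0 \<in> F 0 ` unit_disk" using FD(4)[of 0] by (auto intro!: image_eqI[of _ _ 0])
    have "H holomorphic_on F 0 ` unit_disk"
      by (rule holomorphic_on_subset[OF Hholo]) auto
    then have "(H has_field_derivative deriv H 0) (at (F 0 0))"
      using FD(4)[of 0] holomorphic_derivI[OF _ FDopen[of 0] 0] by simp
    moreover have "(F 0 has_field_derivative 1) (at 0)"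
      using holomorphic_derivI[OF FD(1)[of 0], of 0] FD(5) by simp
    ultimately have "((\<lambda>z. H (F 0 z)) has_field_derivative deriv H 0 * 1) (at 0)"
      by (rule DERIV_chain2)
    then have "(G 0 has_field_derivative deriv H 0) (at 0)"
      using has_field_derivative_transform_within_open[of _ _ 0 unit_disk "G 0"] H by simp
    then show ?thesis using GD(5) DERIV_imp_deriv by metis
  qed
  ultimately show thesis using that Hholo H by blast
qed

text \<open>The transition map rescaled from radius 1 / \<beta> to the unit disk. The last clause
  records the range of \<open>h\<close>, which is what uniqueness uses.\<close>

lemma radial_chain_class_S_factor:
  assumes \<beta>: "\<beta> > 0" and F: "radial_chain F" and G: "radial_chain G"
    and ran: "(\<Union>t\<in>{0..}. F t ` unit_disk) = ball 0 (1 / \<beta>)"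
  obtains h where "class_S h"
    "\<And>t z. 0 \<le> t \<Longrightarrow> norm z < 1 \<Longrightarrow> G t z = h (of_real \<beta> * F t z) / of_real \<beta>"
    "\<And>z. norm z < 1 \<Longrightarrow> h z / of_real \<beta> \<in> (\<Union>t\<in>{0..}. G t ` unit_disk)"
proof -
  obtain H where H: "H holomorphic_on ball 0 (1 / \<beta>)" "inj_on H (ball 0 (1 / \<beta>))" "H 0 = 0" "deriv H 0 = 1"
    "\<And>t z. 0 \<le> t \<Longrightarrow> norm z < 1 \<Longrightarrow> H (F t z) = G t z"
    using radial_chain_transition[OF F G] unfolding ran by metis
  define h where "h = (\<lambda>z. of_real \<beta> * H (z / of_real \<beta>))"
  have maps: "z / of_real \<beta> \<in> ball 0 (1 / \<beta>)" if "z \<in> unit_disk" for z :: complex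
    using that \<beta> by (simp add: norm_divide divide_strict_right_mono)
  have "H \<circ> (\<lambda>z. z / of_real \<beta>) holomorphic_on unit_disk"
    using maps \<beta> by (intro holomorphic_on_compose_gen[OF _ H(1)] holomorphic_intros) auto
  then have 1: "h holomorphic_on unit_disk"
    unfolding h_def by (intro holomorphic_intros) (simp add: o_def)
  have 2: "inj_on h unit_disk"
    using inj_onD[OF H(2) _ maps maps] \<beta> by (auto simp: inj_on_def h_def)
  have "(H has_field_derivative 1) (at (0 / of_real \<beta>))"
    using holomorphic_derivI[OF H(1), of 0] \<beta> H(4) by simp
  then have "((\<lambda>z. H (z / of_real \<beta>)) has_field_derivative 1 * (1 / of_real \<beta>)) (at 0)"
    by (rule DERIV_chain2) (use \<beta> in \<open>auto intro!: derivative_eq_intros\<close>)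
  then have "(h has_field_derivative of_real \<beta> * (1 * (1 / of_real \<beta>))) (at 0)"
    unfolding h_def by (rule DERIV_cmult)
  then have 3: "deriv h 0 = 1" using \<beta> by (simp add: DERIV_imp_deriv)
  have "class_S h" unfolding class_S_def using 1 2 3 H(3) by (simp add: h_def)
  moreover have "G t z = h (of_real \<beta> * F t z) / of_real \<beta>" if "0 \<le> t" "norm z < 1" for t z
    using H(5)[OF that] \<beta> by (simp add: h_def)
  moreover have "h z / of_real \<beta> \<in> (\<Union>t\<in>{0..}. G t ` unit_disk)" if "norm z < 1" for z
  proof -
    have "z / of_real \<beta> \<in> (\<Union>t\<in>{0..}. F t ` unit_disk)" unfolding ran using maps that by simp
    then obtain t \<zeta> where t: "0 \<le> t" "norm \<zeta> < 1" "z / of_real \<beta> = F t \<zeta>" by auto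
    then have "h z / of_real \<beta> = G t \<zeta>" using H(5)[OF t(1,2)] \<beta> by (simp add: h_def)
    moreover have "G t \<zeta> \<in> G t ` unit_disk" using t by simp
    ultimately show ?thesis using t(1) by (metis UN_I atLeast_iff)
  qed
  ultimately show thesis using that by blast
qed

text \<open>Equal ranges make \<open>h\<close> a self-map of the disk with derivative 1 at 0, which
  is the identity by \<open>norm_diff_id_le\<close> with A = 1.\<close>

lemma radial_chain_unique_pos:
  assumes \<beta>: "\<beta> > 0" and F: "radial_chain F" and G: "radial_chain G"
    and ranF: "(\<Union>t\<in>{0..}. F t ` unit_disk) = ball 0 (1 / \<beta>)"
    and ranG: "(\<Union>t\<in>{0..}. G t ` unit_disk) = ball 0 (1 / \<beta>)"
    and tz: "0 \<le> t" "norm z < 1"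
  shows "G t z = F t z"
proof -
  obtain h where h: "class_S h"
    "\<And>t z. 0 \<le> t \<Longrightarrow> norm z < 1 \<Longrightarrow> G t z = h (of_real \<beta> * F t z) / of_real \<beta>"
    "\<And>z. norm z < 1 \<Longrightarrow> h z / of_real \<beta> \<in> ball 0 (1 / \<beta>)"
    using radial_chain_class_S_factor[OF \<beta> F G ranF] unfolding ranG by metis
  have h1: "norm (h z) < 1" if "norm z < 1" for z
    using h(3)[OF that] \<beta> by (simp add: norm_divide divide_less_cancel)
  have hol: "h holomorphic_on unit_disk" "h 0 = 0" "deriv h 0 = 1" using h(1) by (auto simp: class_S_def)
  have id: "h \<zeta> = \<zeta>" if "norm \<zeta> < 1" for \<zeta>
    using norm_diff_id_le(1)[OF hol less_imp_le[OF h1], of \<zeta> "norm \<zeta>"] that by simp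
  have "F t z \<in> F t ` unit_disk" using tz by simp
  then have "F t z \<in> ball 0 (1 / \<beta>)" unfolding ranF[symmetric] using tz(1) by blast
  then have "norm (of_real \<beta> * F t z) < 1" using \<beta> by (simp add: norm_mult field_simps)
  then show ?thesis using h(2)[OF tz] id \<beta> by simp
qed

end

section \<open>General evolution families\<close>

lemma nonneg_Ld_cases:
  assumes "1 \<le> d"
  obtains "d = \<infinity>" | p where "d = ereal p" "1 \<le> p"
  using assms by (cases d) auto

lemma nonneg_Ld_add:
  assumes d: "1 \<le> d" and k: "nonneg_Ld d T k" "nonneg_Ld d T l"
  shows "nonneg_Ld d T (\<lambda>x. k x + l x)"
proof -
  have meas: "set_borel_measurable lebesgue {0..T} (\<lambda>x. k x + l x)"
    using k unfolding nonneg_Ld_def set_borel_measurable_def scaleR_add_right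
    by (intro borel_measurable_add) auto
  have nn: "\<forall>x\<in>{0..T}. 0 \<le> k x + l x"
    using k by (auto simp: nonneg_Ld_def)
  from d show ?thesis
  proof (cases rule: nonneg_Ld_cases)
    case 1
    obtain C D where CD: "AE x in lebesgue. x \<in> {0..T} \<longrightarrow> \<bar>k x\<bar> \<le> C"
      "AE x in lebesgue. x \<in> {0..T} \<longrightarrow> \<bar>l x\<bar> \<le> D"
      using k 1 by (auto simp: nonneg_Ld_def)
    have "AE x in lebesgue. x \<in> {0..T} \<longrightarrow> \<bar>k x + l x\<bar> \<le> C + D"
      using CD by eventually_elim auto
    then show ?thesis using 1 meas nn by (auto simp: nonneg_Ld_def)
  next
    case (2 p)
    have int: "set_integrable lebesgue {0..T} (\<lambda>x. \<bar>k x\<bar> powr p)" "set_integrable lebesgue {0..T} (\<lambda>x. \<bar>l x\<bar> powr p)"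
      using k 2 by (auto simp: nonneg_Ld_def)
    have "set_integrable lebesgue {0..T} (\<lambda>x. \<bar>k x + l x\<bar> powr p)"
    proof (rule set_integrable_bound)
      show "set_integrable lebesgue {0..T} (\<lambda>x. 2 powr p * (\<bar>k x\<bar> powr p + \<bar>l x\<bar> powr p))"
        by (intro set_integrable_mult_right set_integral_add int)
      show "set_borel_measurable lebesgue {0..T} (\<lambda>x. \<bar>k x + l x\<bar> powr p)"
      proof -
        \<comment> \<open>Only the product with the indicator is known to be measurable. Repeating
          the indicator under the absolute value exposes that product.\<close>
        have "(\<lambda>x. indicat_real {0..T} x *\<^sub>R \<bar>k x + l x\<bar> powr p) =
          (\<lambda>x. indicat_real {0..T} x *\<^sub>R \<bar>indicat_real {0..T} x *\<^sub>R (k x + l x)\<bar> powr p)"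
          by (auto simp: indicator_def)
        moreover have "\<dots> \<in> borel_measurable lebesgue"
          by (rule borel_measurable_scaleR[OF borel_measurable_indicator powr_real_measurable[OF
                borel_measurable_abs[OF meas[unfolded set_borel_measurable_def]]]]) auto
        ultimately show ?thesis by (simp add: set_borel_measurable_def)
      qed
      have "norm (\<bar>x + y\<bar> powr p) \<le> norm (2 powr p * (\<bar>x\<bar> powr p + \<bar>y\<bar> powr p))" for x y :: real
      proof -
        have "\<bar>x + y\<bar> powr p \<le> (2 * max \<bar>x\<bar> \<bar>y\<bar>) powr p"
          using 2 by (intro powr_mono2) auto
        also have "\<dots> = 2 powr p * max \<bar>x\<bar> \<bar>y\<bar> powr p"
          by (simp add: powr_mult)
        also have "\<dots> \<le> 2 powr p * (\<bar>x\<bar> powr p + \<bar>y\<bar> powr p)"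
          by (intro mult_left_mono) (auto simp: max_def)
        finally show ?thesis by simp
      qed
      then show "AE x in lebesgue. x \<in> {0..T} \<longrightarrow>
          norm (\<bar>k x + l x\<bar> powr p) \<le> norm (2 powr p * (\<bar>k x\<bar> powr p + \<bar>l x\<bar> powr p))"
        by blast
    qed
    then show ?thesis using 2 meas nn by (simp add: nonneg_Ld_def)
  qed
qed

lemma nonneg_Ld_cmult:
  assumes d: "1 \<le> d" and k: "nonneg_Ld d T k" and c: "0 \<le> c"
  shows "nonneg_Ld d T (\<lambda>x. c * k x)"
proof -
  have "set_borel_measurable lebesgue {0..T} (\<lambda>x. c *\<^sub>R k x)"
    using k unfolding nonneg_Ld_def set_borel_measurable_def
    by (subst scaleR_left_commute) (intro borel_measurable_const_scaleR, auto)
  then have meas: "set_borel_measurable lebesgue {0..T} (\<lambda>x. c * k x)" by simp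
  have nn: "\<forall>x\<in>{0..T}. 0 \<le> c * k x"
    using k c by (auto simp: nonneg_Ld_def)
  from d show ?thesis
  proof (cases rule: nonneg_Ld_cases)
    case 1
    obtain C where C: "AE x in lebesgue. x \<in> {0..T} \<longrightarrow> \<bar>k x\<bar> \<le> C"
      using k 1 by (auto simp: nonneg_Ld_def)
    have "AE x in lebesgue. x \<in> {0..T} \<longrightarrow> \<bar>c * k x\<bar> \<le> c * C"
      using C by eventually_elim (use c in \<open>auto simp: abs_mult mult_left_mono\<close>)
    then show ?thesis using 1 meas nn by (auto simp: nonneg_Ld_def)
  next
    case (2 p)
    have "set_integrable lebesgue {0..T} (\<lambda>x. c powr p * \<bar>k x\<bar> powr p)"
      using k 2 by (intro set_integrable_mult_right) (auto simp: nonneg_Ld_def)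
    then show ?thesis using 2 meas nn c by (simp add: nonneg_Ld_def abs_mult powr_mult)
  qed
qed

text \<open>On a bounded interval constants are integrable, and |y| \<le> 1 + |y|^p for p \<ge>
  1.\<close>

lemma nonneg_Ld_integrable:
  assumes d: "1 \<le> d" and k: "nonneg_Ld d T k"
  shows "k integrable_on {0..T}"
proof -
  have meas: "set_borel_measurable lebesgue {0..T} k" using k by (simp add: nonneg_Ld_def)
  have const: "set_integrable lebesgue {0..T} (\<lambda>x. c)" for c :: real
    by (rule absolutely_integrable_on_const) simp
  have "set_integrable lebesgue {0..T} k"
    using d
  proof (cases rule: nonneg_Ld_cases)
    case 1
    then obtain C where C: "AE x in lebesgue. x \<in> {0..T} \<longrightarrow> \<bar>k x\<bar> \<le> C"
      using k by (auto simp: nonneg_Ld_def)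
    show ?thesis
    proof (rule set_integrable_bound[OF const meas])
      show "AE x in lebesgue. x \<in> {0..T} \<longrightarrow> norm (k x) \<le> norm C"
        using C by eventually_elim auto
    qed
  next
    case (2 p)
    have "set_integrable lebesgue {0..T} (\<lambda>x. 1 + \<bar>k x\<bar> powr p)"
      using k 2 by (intro set_integral_add const) (auto simp: nonneg_Ld_def)
    moreover have "\<bar>y\<bar> \<le> 1 + \<bar>y\<bar> powr p" for y :: real
    proof (cases "\<bar>y\<bar> \<le> 1")
      case False
      then show ?thesis using powr_mono[of 1 p "\<bar>y\<bar>"] 2 by simp
    qed (auto intro: add_increasing2)
    ultimately show ?thesis
      by (rule_tac set_integrable_bound[OF _ meas]) (auto intro!: always_eventually)
  qed
  then show ?thesis by (rule set_lebesgue_integral_eq_integral(1))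
qed

section \<open>Lipschitz bounds, injectivity and uniform confinement\<close>

lemma holomorphic_Lipschitz_cball:
  assumes f: "f holomorphic_on unit_disk" and R: "R < R'" "R' < 1"
    and B: "\<And>z. norm z \<le> R' \<Longrightarrow> norm (f z) \<le> B"
    and xy: "norm x \<le> R" "norm y \<le> R"
  shows "norm (f x - f y) \<le> B / (R' - R) * norm (x - y)"
proof (rule field_differentiable_bound[of "cball 0 R" f "deriv f"])
  fix z :: complex assume z: "z \<in> cball 0 R"
  then show "(f has_field_derivative deriv f z) (at z within cball 0 R)"
    using holomorphic_derivI[OF f, of z] R by auto
  have sub: "cball z (R' - R) \<subseteq> cball 0 R'"
    using z R by (simp add: cball_subset_cball_iff)
  then have sub': "cball z (R' - R) \<subseteq> unit_disk" "ball z (R' - R) \<subseteq> unit_disk"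
    using R ball_subset_cball by fastforce+
  have "norm ((deriv ^^ 1) f z) \<le> fact 1 * B / (R' - R) ^ 1"
  proof (rule Cauchy_inequality)
    show "f holomorphic_on ball z (R' - R)" "continuous_on (cball z (R' - R)) f"
      using f sub' by (auto intro: holomorphic_on_imp_continuous_on holomorphic_on_subset)
    fix w assume "norm (z - w) = R' - R"
    then have "w \<in> cball 0 R'" using sub by (auto simp: dist_norm subset_iff)
    then show "norm (f w) \<le> B" using B by simp
  qed (use R in auto)
  then show "norm (deriv f z) \<le> B / (R' - R)" by simp
qed (use xy in auto)

text \<open>By Cauchy's estimate \<open>f - id\<close> is Lipschitz with constant
  \<open>e / (R' - R) < 1\<close>, so it cannot cancel the difference of two distinct
  points.\<close>

lemma inj_on_near_identity:
  assumes f: "f holomorphic_on unit_disk" and R: "R < R'" "R' < 1"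
    and e: "\<And>z. norm z \<le> R' \<Longrightarrow> norm (f z - z) \<le> e" "e < R' - R"
  shows "inj_on f (cball 0 R)"
proof (rule inj_onI, rule ccontr)
  fix x y assume xy: "x \<in> cball 0 R" "y \<in> cball 0 R" "f x = f y" "x \<noteq> y"
  have "norm ((f x - x) - (f y - y)) \<le> e / (R' - R) * norm (x - y)"
    using xy f e by (intro holomorphic_Lipschitz_cball[OF _ R] holomorphic_intros) auto
  also have "\<dots> < 1 * norm (x - y)"
    using xy e R by (intro mult_strict_right_mono) auto
  finally show False using xy by (simp add: norm_minus_commute)
qed

text \<open>Compactness in the pair (a, z) makes the bound uniform in the parameter
  \<open>a\<close>, which later is a moving point of the orbit of 0.\<close>

lemma Moebius_function_confined:
  assumes "R1 < 1" "R2 < 1"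
  obtains R where "0 \<le> R" "R < 1"
    "\<And>a z. norm a \<le> R1 \<Longrightarrow> norm z \<le> R2 \<Longrightarrow> norm (Moebius_function 0 a z) \<le> R"
proof -
  let ?g = "\<lambda>p :: complex \<times> complex. (snd p - fst p) / (1 - cnj (fst p) * snd p)"
  let ?K = "?g ` (cball 0 R1 \<times> cball 0 R2)"
  have "1 - cnj a * z \<noteq> 0" if "norm a \<le> R1" "norm z \<le> R2" for a z
  proof
    assume "1 - cnj a * z = 0"
    then have "norm (cnj a * z) = 1" by (metis eq_iff_diff_eq_0 norm_one)
    moreover have "norm (cnj a * z) < 1 * 1"
      unfolding norm_mult using that assms by (intro mult_strict_mono') auto
    ultimately show False by simp
  qed
  then have "compact ?K"
    by (intro compact_continuous_image compact_Times continuous_intros) auto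
  moreover have "?K \<subseteq> unit_disk"
  proof (clarsimp simp del: norm_divide)
    fix a z :: complex assume "norm a \<le> R1" "norm z \<le> R2"
    then show "norm ((z - a) / (1 - cnj a * z)) < 1"
      using Moebius_function_norm_lt_1[of a z 0] assms by (simp add: Moebius_function_simple)
  qed
  ultimately obtain R where R: "0 \<le> R" "R < 1" "?K \<subseteq> cball 0 R"
    by (rule compact_subset_cball)
  have "norm (Moebius_function 0 a z) \<le> R" if "norm a \<le> R1" "norm z \<le> R2" for a z
  proof -
    have "?g (a, z) \<in> ?K" using that by (intro imageI) simp
    then show ?thesis using R by (auto simp: Moebius_function_simple)
  qed
  with R that show thesis by blast
qed

section \<open>Regularity in time, the radial conjugate and univalence\<close>

locale evolution =
  fixes d :: ereal and \<phi> :: "real \<Rightarrow> real \<Rightarrow> complex \<Rightarrow> complex"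
  assumes d: "1 \<le> d" and ef: "evolution_family d \<phi>"
begin

lemma holo: "0 \<le> s \<Longrightarrow> s \<le> t \<Longrightarrow> \<phi> s t holomorphic_on unit_disk"
  and self: "0 \<le> s \<Longrightarrow> s \<le> t \<Longrightarrow> norm z < 1 \<Longrightarrow> norm (\<phi> s t z) < 1"
  and ident: "0 \<le> s \<Longrightarrow> norm z < 1 \<Longrightarrow> \<phi> s s z = z"
  and comp: "0 \<le> s \<Longrightarrow> s \<le> u \<Longrightarrow> u \<le> t \<Longrightarrow> norm z < 1 \<Longrightarrow> \<phi> u t (\<phi> s u z) = \<phi> s t z"
  using ef unfolding evolution_family_def by (auto simp: image_subset_iff)

text \<open>The definition allows a different kernel for every point. By
  \<open>displacement_bound\<close> the sum of the kernels for 0 and 1/2 serves all points at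
  once.\<close>

lemma displacement_kernel:
  assumes "T > 0"
  obtains k where "nonneg_Ld d T k"
    "\<And>s t z r. 0 \<le> s \<Longrightarrow> s \<le> t \<Longrightarrow> t \<le> T \<Longrightarrow> norm z \<le> r \<Longrightarrow> r < 1 \<Longrightarrow>
       norm (\<phi> s t z - z) \<le> 17 / (1 - r) * integral {s..t} k"
proof -
  have *: "\<exists>k. nonneg_Ld d T k \<and> (\<forall>s t. 0 \<le> s \<and> s \<le> t \<and> t \<le> T \<longrightarrow> norm (\<phi> s t z - z) \<le> integral {s..t} k)"
    if z: "norm z < 1" for z
  proof -
    obtain k where k: "nonneg_Ld d T k"
      "\<And>s u t. 0 \<le> s \<and> s \<le> u \<and> u \<le> t \<and> t \<le> T \<Longrightarrow> norm (\<phi> s u z - \<phi> s t z) \<le> integral {u..t} k"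
      using ef assms z unfolding evolution_family_def by (metis mem_ball_0)
    have "norm (\<phi> s t z - z) \<le> integral {s..t} k" if "0 \<le> s" "s \<le> t" "t \<le> T" for s t
      using k(2)[of s s t] that ident[OF that(1) z] by (simp add: norm_minus_commute)
    with k(1) show ?thesis by blast
  qed
  obtain k where k: "nonneg_Ld d T k"
    "\<And>s t. 0 \<le> s \<Longrightarrow> s \<le> t \<Longrightarrow> t \<le> T \<Longrightarrow> norm (\<phi> s t 0 - 0) \<le> integral {s..t} k"
    using *[of 0] by (metis norm_zero zero_less_one)
  have "norm (1/2 :: complex) < 1" by (simp add: norm_divide)
  from *[OF this] obtain l where l: "nonneg_Ld d T l"
    "\<And>s t. 0 \<le> s \<Longrightarrow> s \<le> t \<Longrightarrow> t \<le> T \<Longrightarrow> norm (\<phi> s t (1/2) - 1/2) \<le> integral {s..t} l"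
    by blast
  show thesis
  proof
    show "nonneg_Ld d T (\<lambda>x. k x + l x)" by (rule nonneg_Ld_add[OF d k(1) l(1)])
    fix s t r and z :: complex assume st: "0 \<le> s" "s \<le> t" "t \<le> T" and z: "norm z \<le> r" "r < 1"
    have "k integrable_on {s..t}" "l integrable_on {s..t}"
      using nonneg_Ld_integrable[OF d k(1)] nonneg_Ld_integrable[OF d l(1)] st
      by (auto intro: integrable_on_subinterval)
    then have "norm (\<phi> s t 0) + norm (\<phi> s t (1/2) - 1/2) \<le> integral {s..t} (\<lambda>x. k x + l x)"
      using k(2)[OF st] l(2)[OF st] by (simp add: integral_add)
    then have "17 / (1 - r) * (norm (\<phi> s t 0) + norm (\<phi> s t (1/2) - 1/2)) \<le> 17 / (1 - r) * integral {s..t} (\<lambda>x. k x + l x)"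
      using z by (intro mult_left_mono) auto
    then show "norm (\<phi> s t z - z) \<le> 17 / (1 - r) * integral {s..t} (\<lambda>x. k x + l x)"
      using displacement_bound[OF holo[OF st(1,2)] self[OF st(1,2)] z] by linarith
  qed
qed

definition a :: "real \<Rightarrow> complex" where "a t = \<phi> 0 t 0"

lemma norm_a: "0 \<le> t \<Longrightarrow> norm (a t) < 1"
  unfolding a_def by (rule self) auto

lemma a_0 [simp]: "a 0 = 0"
  by (simp add: a_def ident)

lemma phi_a: "0 \<le> s \<Longrightarrow> s \<le> t \<Longrightarrow> \<phi> s t (a s) = a t"
  unfolding a_def by (rule comp) auto

text \<open>The kernel for the point 0 makes \<open>a\<close> continuous, so its image of a bounded
  time interval is compact.\<close>

lemma a_confined:
  assumes T: "T > 0"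
  obtains R where "0 \<le> R" "R < 1" "\<And>t. 0 \<le> t \<Longrightarrow> t \<le> T \<Longrightarrow> norm (a t) \<le> R"
proof -
  obtain k where k: "nonneg_Ld d T k"
    "\<And>s u t. 0 \<le> s \<and> s \<le> u \<and> u \<le> t \<and> t \<le> T \<Longrightarrow> norm (\<phi> s u 0 - \<phi> s t 0) \<le> integral {u..t} k"
    using ef T unfolding evolution_family_def by (metis centre_in_ball zero_less_one)
  have int: "k integrable_on {0..T}" by (rule nonneg_Ld_integrable[OF d k(1)])
  define I where "I = (\<lambda>t. integral {0..t} k)"
  have I: "continuous_on {0..T} I"
    unfolding I_def by (rule indefinite_integral_continuous_1[OF int])
  have le: "norm (a u - a t) \<le> \<bar>I t - I u\<bar>" if "0 \<le> u" "u \<le> t" "t \<le> T" for u t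
  proof -
    have "integral {0..u} k + integral {u..t} k = integral {0..t} k"
      using int that by (intro Henstock_Kurzweil_Integration.integral_combine) (auto intro: integrable_on_subinterval)
    then show ?thesis using k(2)[of 0 u t] that by (simp add: I_def a_def)
  qed
  have le': "dist (a u) (a t) \<le> dist (I u) (I t)" if "u \<in> {0..T}" "t \<in> {0..T}" for u t
    using le[of u t] le[of t u] that by (cases "u \<le> t") (auto simp: dist_norm norm_minus_commute)
  have "continuous_on {0..T} a"
    using I le' unfolding continuous_on_iff by (meson le_less_trans)
  then have "compact (a ` {0..T})" by (intro compact_continuous_image) auto
  moreover have "a ` {0..T} \<subseteq> unit_disk" using norm_a by auto
  ultimately obtain R where "0 \<le> R" "R < 1" "a ` {0..T} \<subseteq> cball 0 R"
    by (rule compact_subset_cball)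
  then show thesis using that[of R] by (auto simp: image_subset_iff)
qed

text \<open>The argument 0 is the rotation angle; \<open>M t\<close> moves \<open>a t\<close> to
  0.\<close>

abbreviation M :: "real \<Rightarrow> complex \<Rightarrow> complex" where "M t \<equiv> Moebius_function 0 (a t)"
abbreviation N :: "real \<Rightarrow> complex \<Rightarrow> complex" where "N t \<equiv> Moebius_function 0 (- a t)"

lemma M_norm: "0 \<le> t \<Longrightarrow> norm z < 1 \<Longrightarrow> norm (M t z) < 1"
  and N_norm: "0 \<le> t \<Longrightarrow> norm z < 1 \<Longrightarrow> norm (N t z) < 1"
  and M_holo: "0 \<le> t \<Longrightarrow> M t holomorphic_on unit_disk"
  and N_holo: "0 \<le> t \<Longrightarrow> N t holomorphic_on unit_disk"
  and MN: "0 \<le> t \<Longrightarrow> norm z < 1 \<Longrightarrow> M t (N t z) = z"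
  and NM: "0 \<le> t \<Longrightarrow> norm z < 1 \<Longrightarrow> N t (M t z) = z"
  by (auto intro!: Moebius_function_norm_lt_1 Moebius_function_holomorphic Moebius_function_compose simp: norm_a)

lemma Moebius_0 [simp]: "Moebius_function 0 0 z = z"
  and N_zero [simp]: "N t 0 = a t" and M_a [simp]: "M t (a t) = 0"
  by (simp_all add: Moebius_function_simple)

text \<open>Moving the orbit \<open>a t\<close> of the origin back to \<open>0\<close> makes the evolution family radial; the
  invariance of the hyperbolic metric turns \<open>\<beta>\<close> into the limit of \<open>\<bar>(\<psi> 0 t)' 0\<bar>\<close>.\<close>

definition \<psi> :: "real \<Rightarrow> real \<Rightarrow> complex \<Rightarrow> complex" where
  "\<psi> s t z = M t (\<phi> s t (N s z))"

lemma psi_holo: "0 \<le> s \<Longrightarrow> s \<le> t \<Longrightarrow> \<psi> s t holomorphic_on unit_disk"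
proof -
  assume st: "0 \<le> s" "s \<le> t"
  have "M t \<circ> (\<phi> s t \<circ> N s) holomorphic_on unit_disk"
    using st self N_norm
    by (intro holomorphic_on_compose_gen[OF _ M_holo] holomorphic_on_compose_gen[OF _ holo] N_holo) auto
  then show ?thesis unfolding \<psi>_def[abs_def] by (simp add: o_def)
qed

lemma psi_self: "0 \<le> s \<Longrightarrow> s \<le> t \<Longrightarrow> norm z < 1 \<Longrightarrow> norm (\<psi> s t z) < 1"
  unfolding \<psi>_def by (intro M_norm self N_norm) auto

lemma psi_zero: "0 \<le> s \<Longrightarrow> s \<le> t \<Longrightarrow> \<psi> s t 0 = 0"
  by (simp add: \<psi>_def phi_a)

lemma phi_psi: "0 \<le> s \<Longrightarrow> s \<le> t \<Longrightarrow> norm z < 1 \<Longrightarrow> \<phi> s t z = N t (\<psi> s t (M s z))"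
  by (simp add: \<psi>_def NM self)

text \<open>In the moving coordinates the origin is fixed, so by Schwarz \<psi> does not increase
  the modulus. Only the two changes of coordinates can, and their parameters are confined.\<close>

lemma phi_confined:
  assumes T: "T > 0" and r: "r < 1"
  obtains R where "0 \<le> R" "R < 1"
    "\<And>s t z. 0 \<le> s \<Longrightarrow> s \<le> t \<Longrightarrow> t \<le> T \<Longrightarrow> norm z \<le> r \<Longrightarrow> norm (\<phi> s t z) \<le> R"
proof -
  obtain Ra where Ra: "Ra < 1" "\<And>t. 0 \<le> t \<Longrightarrow> t \<le> T \<Longrightarrow> norm (a t) \<le> Ra"
    using a_confined[OF T] by metis
  obtain R1 where R1: "R1 < 1" "\<And>a z. norm a \<le> Ra \<Longrightarrow> norm z \<le> r \<Longrightarrow> norm (Moebius_function 0 a z) \<le> R1"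
    using Moebius_function_confined[OF Ra(1) r] by metis
  obtain R where R: "0 \<le> R" "R < 1" "\<And>a z. norm a \<le> Ra \<Longrightarrow> norm z \<le> R1 \<Longrightarrow> norm (Moebius_function 0 a z) \<le> R"
    using Moebius_function_confined[OF Ra(1) R1(1)] by metis
  show thesis
  proof
    fix s t and z :: complex assume st: "0 \<le> s" "s \<le> t" "t \<le> T" and z: "norm z \<le> r"
    have "norm (M s z) \<le> R1" using R1(2) Ra(2) st z by simp
    moreover have "norm (M s z) < 1" using M_norm st z r by simp
    ultimately have "norm (\<psi> s t (M s z)) \<le> R1"
      using Schwarz_Lemma(1)[OF psi_holo psi_zero psi_self, of s t "M s z"] st by simp
    then have "norm (N t (\<psi> s t (M s z))) \<le> R" using R(3) Ra(2) st by simp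
    then show "norm (\<phi> s t z) \<le> R" using phi_psi[of s t z] st z r by simp
  qed (use R in auto)
qed

text \<open>Orbits of points of modulus at most \<open>r\<close> stay in a fixed smaller disk, on which \<open>\<phi> u v\<close> is close
  to the identity, hence injective, as soon as \<open>v - u\<close> is small.\<close>

lemma phi_inj:
  assumes st: "0 \<le> s" "s \<le> t"
  shows "inj_on (\<phi> s t) unit_disk"
proof (rule inj_onI)
  fix z w :: complex assume zw: "z \<in> unit_disk" "w \<in> unit_disk" and eq: "\<phi> s t z = \<phi> s t w"
  define r where "r = max (norm z) (norm w)"
  \<comment> \<open>Adding 1 keeps the time horizon positive even for \<open>t = 0\<close>.\<close>
  define T where "T = t + 1"
  have T: "T > 0" using st by (simp add: T_def)
  have r: "r < 1" "norm z \<le> r" "norm w \<le> r" using zw by (auto simp: r_def)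
  obtain R where R: "0 \<le> R" "R < 1"
    "\<And>s t z. 0 \<le> s \<Longrightarrow> s \<le> t \<Longrightarrow> t \<le> T \<Longrightarrow> norm z \<le> r \<Longrightarrow> norm (\<phi> s t z) \<le> R"
    using phi_confined[OF T r(1)] by metis
  define R' where "R' = (1 + R) / 2"
  have R': "R < R'" "R' < 1" using R by (auto simp: R'_def)
  obtain k where k: "nonneg_Ld d T k"
    "\<And>s t z r. 0 \<le> s \<Longrightarrow> s \<le> t \<Longrightarrow> t \<le> T \<Longrightarrow> norm z \<le> r \<Longrightarrow> r < 1 \<Longrightarrow>
       norm (\<phi> s t z - z) \<le> 17 / (1 - r) * integral {s..t} k"
    using displacement_kernel[OF T] by metis
  have int: "k integrable_on {0..T}" by (rule nonneg_Ld_integrable[OF d k(1)])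
  define I where "I = (\<lambda>t. 17 / (1 - R') * integral {0..t} k)"
  have "uniformly_continuous_on {0..T} I"
    unfolding I_def
    by (intro compact_uniformly_continuous continuous_intros indefinite_integral_continuous_1[OF int]) simp
  then obtain \<delta> where \<delta>: "\<delta> > 0"
    "\<And>u v. u \<in> {0..T} \<Longrightarrow> v \<in> {0..T} \<Longrightarrow> dist u v < \<delta> \<Longrightarrow> dist (I u) (I v) < R' - R"
    unfolding uniformly_continuous_on_def using R' by (metis diff_gt_0_iff_gt dist_commute)
  have short: "inj_on (\<phi> u v) (cball 0 R)" if uv: "0 \<le> u" "u \<le> v" "v \<le> T" "v - u < \<delta>" for u v
  proof (rule inj_on_near_identity[OF holo[OF uv(1,2)] R'])
    have "integral {0..u} k + integral {u..v} k = integral {0..v} k"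
      using int uv by (intro Henstock_Kurzweil_Integration.integral_combine) (auto intro: integrable_on_subinterval)
    then have "integral {u..v} k = integral {0..v} k - integral {0..u} k" by simp
    then have "17 / (1 - R') * integral {u..v} k = I v - I u"
      by (simp add: I_def right_diff_distrib)
    then show "norm (\<phi> u v \<zeta> - \<zeta>) \<le> I v - I u" if "norm \<zeta> \<le> R'" for \<zeta>
      using k(2)[OF uv(1-3) that R'(2)] by simp
    show "I v - I u < R' - R"
      using \<delta>(2)[of u v] uv by (auto simp: dist_real_def)
  qed
  \<comment> \<open>Induction on the number of time steps of length at most
    \<open>\<delta> / 2\<close>, removing the last one: both orbits are then in
    \<open>cball 0 R\<close>, where the short map is injective.\<close>
  have steps: "\<phi> s t z = \<phi> s t w \<Longrightarrow> z = w" if "0 \<le> s" "s \<le> t" "t \<le> T" "t - s \<le> real n * (\<delta> / 2)" for s t n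
    using that
  proof (induction n arbitrary: t)
    case 0
    then have "s = t" by simp
    then show ?case using 0 ident zw by simp
  next
    case (Suc n)
    define m where "m = max s (t - \<delta> / 2)"
    have m: "0 \<le> m" "s \<le> m" "m \<le> t" "t - m < \<delta>" "m - s \<le> real n * (\<delta> / 2)" "m \<le> T"
      using Suc.prems \<delta>(1) by (auto simp: m_def max_def algebra_simps)
    have "\<phi> m t (\<phi> s m z) = \<phi> m t (\<phi> s m w)"
      using Suc.prems m zw by (simp add: comp)
    then have "\<phi> s m z = \<phi> s m w"
      using inj_onD[OF short[of m t]] m Suc.prems R(3)[of s m] r by simp
    then show ?case using Suc.IH[of m] Suc.prems m by simp
  qed
  obtain n where "(t - s) / (\<delta> / 2) \<le> real n" using real_arch_simple by blast
  then have "t - s \<le> real n * (\<delta> / 2)" using \<delta>(1) by (simp add: field_simps)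
  then show "z = w" using steps[of s t n] st eq by (simp add: T_def)
qed

lemma psi_inj:
  assumes st: "0 \<le> s" "s \<le> t"
  shows "inj_on (\<psi> s t) unit_disk"
proof (rule inj_onI)
  fix z w :: complex assume zw: "z \<in> unit_disk" "w \<in> unit_disk" and eq: "\<psi> s t z = \<psi> s t w"
  have n: "norm (N s z) < 1" "norm (N s w) < 1" using N_norm st zw by auto
  have "N t (\<psi> s t z) = N t (\<psi> s t w)" using eq by simp
  then have "\<phi> s t (N s z) = \<phi> s t (N s w)"
    using st n self by (simp add: \<psi>_def NM)
  then have "N s z = N s w" using inj_onD[OF phi_inj[OF st]] n by simp
  then show "z = w" using MN st zw by (metis mem_ball_0)
qed

text \<open>The derivative of \<open>M t\<close> at \<open>a t\<close> is 1 / (1 - |a t|^2), and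
  \<open>N 0\<close> is the identity because \<open>a 0 = 0\<close>.\<close>

lemma deriv_psi_0:
  assumes t: "0 \<le> t"
  shows "norm (deriv (\<psi> 0 t) 0) = norm (deriv (\<phi> 0 t) 0) / (1 - (norm (\<phi> 0 t 0))\<^sup>2)"
proof -
  have nz: "1 - cnj (a t) * a t \<noteq> 0"
  proof -
    have "norm (a t) * norm (a t) < 1 * 1"
      using norm_a[OF t] by (intro mult_strict_mono') auto
    then show ?thesis
      by (metis eq_iff_diff_eq_0 complex_mod_cnj norm_mult norm_one mult_1 less_irrefl)
  qed
  have "(M t has_field_derivative 1 / (1 - cnj (a t) * a t)) (at (a t))"
    unfolding Moebius_function_simple using nz
    by (auto intro!: derivative_eq_intros simp: divide_simps)
  moreover have "(\<phi> 0 t has_field_derivative deriv (\<phi> 0 t) 0) (at 0)"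
    using holomorphic_derivI[OF holo[OF order_refl t], of 0] by simp
  ultimately have "((\<lambda>z. M t (\<phi> 0 t z)) has_field_derivative 1 / (1 - cnj (a t) * a t) * deriv (\<phi> 0 t) 0) (at 0)"
    unfolding a_def by (intro DERIV_chain2) auto
  then have "deriv (\<psi> 0 t) 0 = 1 / (1 - cnj (a t) * a t) * deriv (\<phi> 0 t) 0"
    unfolding \<psi>_def[abs_def] by (simp add: DERIV_imp_deriv)
  moreover have "1 - cnj (a t) * a t = of_real (1 - (norm (a t))\<^sup>2)"
    using complex_norm_square[of "a t"] by (simp add: mult.commute)
  moreover have "1 - (norm (a t))\<^sup>2 > 0"
    using norm_a[OF t] by (simp add: abs_square_less_1)
  ultimately show ?thesis
    by (simp add: norm_divide norm_mult a_def del: of_real_diff)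
qed

lemma radial_evolution_psi:
  assumes "((\<lambda>t. cmod (deriv (\<phi> 0 t) 0) / (1 - (cmod (\<phi> 0 t 0))\<^sup>2)) \<longlongrightarrow> \<beta>) at_top"
  shows "radial_evolution \<psi> \<beta>"
proof
  show "\<psi> u t (\<psi> s u z) = \<psi> s t z" if "0 \<le> s" "s \<le> u" "u \<le> t" "norm z < 1" for s u t z
    using that N_norm[of s z] by (simp add: \<psi>_def NM self comp)
  show "((\<lambda>t. norm (deriv (\<psi> 0 t) 0)) \<longlongrightarrow> \<beta>) at_top"
    by (rule Lim_transform_eventually[OF assms])
       (auto intro: eventually_mono[OF eventually_ge_at_top[of 0]] simp: deriv_psi_0)
qed (auto intro: psi_holo psi_self psi_inj simp: psi_zero)

end

section \<open>Transfer of chains between \<phi> and \<psi>\<close>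

locale evolution_with_beta = evolution +
  fixes \<beta> :: real
  assumes beta: "((\<lambda>t. cmod (deriv (\<phi> 0 t) 0) / (1 - (cmod (\<phi> 0 t 0))\<^sup>2)) \<longlongrightarrow> \<beta>) at_top"
begin

sublocale R: radial_evolution \<psi> \<beta>
  by (rule radial_evolution_psi[OF beta])

lemma radial_chain_of_normalized:
  assumes g: "normalized_chain g" "associated_with g \<phi>"
  shows "R.radial_chain (\<lambda>t z. g t (N t z))"
  unfolding R.radial_chain_def
proof (intro conjI allI impI)
  have lc: "g t holomorphic_on unit_disk" "inj_on (g t) unit_disk" if "0 \<le> t" for t
    using g(1) that by (auto simp: normalized_chain_def loewner_chain_def loewner_chain_order_def)
  fix t :: real assume t: "0 \<le> t"
  have "g t \<circ> N t holomorphic_on unit_disk"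
    using t N_norm by (intro holomorphic_on_compose_gen[OF N_holo lc(1)]) auto
  then show "(\<lambda>z. g t (N t z)) holomorphic_on unit_disk" by (simp add: o_def)
  show "inj_on (\<lambda>z. g t (N t z)) unit_disk"
  proof (rule inj_onI)
    fix z w :: complex assume zw: "z \<in> unit_disk" "w \<in> unit_disk" "g t (N t z) = g t (N t w)"
    then have "N t z = N t w"
      using inj_onD[OF lc(2)[OF t]] N_norm[OF t] by simp
    then show "z = w" using MN t zw by (metis mem_ball_0)
  qed
next
  fix s t :: real and z :: complex assume st: "0 \<le> s \<and> s \<le> t \<and> norm z < 1"
  then have "N t (\<psi> s t z) = \<phi> s t (N s z)" by (simp add: \<psi>_def NM self N_norm)
  then show "g t (N t (\<psi> s t z)) = g s (N s z)"
    using g(2) st N_norm[of s z] by (simp add: associated_with_def)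
qed (use g in \<open>auto simp: normalized_chain_def\<close>)

lemma image_M:
  assumes t: "0 \<le> t"
  shows "M t ` unit_disk = unit_disk"
proof (intro equalityI subsetI)
  show "z \<in> M t ` unit_disk" if "z \<in> unit_disk" for z
    by (rule image_eqI[of _ _ "N t z"]) (use that MN N_norm t in auto)
qed (use M_norm t in auto)

lemma image_N:
  assumes t: "0 \<le> t"
  shows "N t ` unit_disk = unit_disk"
proof (intro equalityI subsetI)
  show "z \<in> N t ` unit_disk" if "z \<in> unit_disk" for z
    by (rule image_eqI[of _ _ "M t z"]) (use that NM M_norm t in auto)
qed (use N_norm t in auto)

text \<open>Regularity comes from f s z - f t z = f t (\<phi> s t z) - f t z: a Lipschitz bound for
  \<open>f t\<close>, uniform up to time \<open>T\<close>, times the displacement. The chain thus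
  inherits the order \<open>d\<close>.\<close>

lemma normalized_of_radial_chain:
  assumes F: "R.radial_chain F"
  defines "f \<equiv> \<lambda>t z. F t (M t z)"
  shows "normalized_chain f" "associated_with f \<phi>"
proof -
  note FD = R.radial_chainD[OF F]
  have assoc: "f t (\<phi> s t z) = f s z" if st: "0 \<le> s" "s \<le> t" and z: "norm z < 1" for s t z
  proof -
    have "f t (\<phi> s t z) = F t (\<psi> s t (M s z))"
      using st z by (simp add: f_def \<psi>_def NM)
    then show ?thesis using FD(3)[OF st M_norm] st z by (simp add: f_def)
  qed
  then show "associated_with f \<phi>" by (simp add: associated_with_def)
  have holo_f: "f t holomorphic_on unit_disk" if t: "0 \<le> t" for t
  proof -
    have "F t \<circ> M t holomorphic_on unit_disk"
      using t M_norm by (intro holomorphic_on_compose_gen[OF M_holo FD(1)]) auto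
    then show ?thesis by (simp add: f_def o_def)
  qed
  have inj_f: "inj_on (f t) unit_disk" if t: "0 \<le> t" for t
  proof (rule inj_onI)
    fix z w :: complex assume zw: "z \<in> unit_disk" "w \<in> unit_disk" "f t z = f t w"
    then have "M t z = M t w"
      using inj_onD[OF FD(2)[OF t]] M_norm[OF t] by (simp add: f_def)
    then show "z = w" using NM t zw by (metis mem_ball_0)
  qed
  have "loewner_chain_order d f"
    unfolding loewner_chain_order_def
  proof (intro conjI allI impI)
    fix s t :: real assume st: "0 \<le> s \<and> s < t"
    show "f s ` unit_disk \<subseteq> f t ` unit_disk"
    proof (rule image_subsetI)
      fix z :: complex assume "z \<in> unit_disk"
      then show "f s z \<in> f t ` unit_disk"
        using assoc[of s t z] self[of s t z] st by (intro image_eqI[of _ _ "\<phi> s t z"]) auto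
    qed
  next
    fix K :: "complex set" and T :: real
    assume "compact K \<and> K \<subseteq> unit_disk \<and> T > 0"
    then have K: "compact K" "K \<subseteq> unit_disk" and T: "T > 0" by auto
    obtain r where r: "0 \<le> r" "r < 1" "K \<subseteq> cball 0 r"
      using K by (rule compact_subset_cball)
    obtain R where R: "0 \<le> R" "R < 1"
      "\<And>s t z. 0 \<le> s \<Longrightarrow> s \<le> t \<Longrightarrow> t \<le> T \<Longrightarrow> norm z \<le> r \<Longrightarrow> norm (\<phi> s t z) \<le> R"
      using phi_confined[OF T r(2)] by metis
    define R' where "R' = (1 + R) / 2"
    have R': "R < R'" "R' < 1" using R by (auto simp: R'_def)
    obtain Ra where Ra: "Ra < 1" "\<And>t. 0 \<le> t \<Longrightarrow> t \<le> T \<Longrightarrow> norm (a t) \<le> Ra"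
      using a_confined[OF T] by metis
    obtain \<rho> where \<rho>: "0 \<le> \<rho>" "\<rho> < 1"
      "\<And>a z. norm a \<le> Ra \<Longrightarrow> norm z \<le> R' \<Longrightarrow> norm (Moebius_function 0 a z) \<le> \<rho>"
      using Moebius_function_confined[OF Ra(1) R'(2)] by metis
    obtain C where C: "C > 0" "\<And>f z. class_S f \<Longrightarrow> norm z \<le> \<rho> \<Longrightarrow> norm (f z) \<le> C"
      using class_S_locally_bounded[OF \<rho>(1,2)] by metis
    obtain k where k: "nonneg_Ld d T k"
      "\<And>s t z r. 0 \<le> s \<Longrightarrow> s \<le> t \<Longrightarrow> t \<le> T \<Longrightarrow> norm z \<le> r \<Longrightarrow> r < 1 \<Longrightarrow>
         norm (\<phi> s t z - z) \<le> 17 / (1 - r) * integral {s..t} k"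
      using displacement_kernel[OF T] by metis
    \<comment> \<open>The class S bounds \<open>b t * F t\<close>; dividing by the smallest |b t| on
      the interval, which is attained at \<open>T\<close>, bounds \<open>f t\<close> uniformly on
      the disk of radius \<open>R'\<close>.\<close>
    define B where "B = C / norm (R.b T)"
    have bT: "norm (R.b T) > 0" using R.b_nonzero[of T] T by simp
    have f_le: "norm (f t z) \<le> B" if t: "0 \<le> t" "t \<le> T" and z: "norm z \<le> R'" for t z
    proof -
      have "norm (R.b t * F t (M t z)) \<le> C"
        using C(2)[OF R.radial_chain_class_S[OF F t(1)]] \<rho>(3) Ra(2)[OF t] z by simp
      then have "norm (R.b t) * norm (f t z) \<le> C" by (simp add: f_def norm_mult)
      moreover have "norm (R.b T) * norm (f t z) \<le> norm (R.b t) * norm (f t z)"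
        using R.norm_b_antimono[OF t] by (intro mult_right_mono) auto
      ultimately have "norm (R.b T) * norm (f t z) \<le> C" by linarith
      then show ?thesis using bT by (simp add: B_def pos_le_divide_eq mult.commute)
    qed
    define L where "L = B / (R' - R) * (17 / (1 - R))"
    have B: "B \<ge> 0" using C bT by (simp add: B_def)
    have L: "L \<ge> 0" using B R R' by (simp add: L_def)
    have "norm (f s z - f t z) \<le> integral {s..t} (\<lambda>x. L * k x)"
      if z: "z \<in> K" and st: "0 \<le> s" "s \<le> t" "t \<le> T" for z s t
    proof -
      have zr: "norm z \<le> r" using z r by auto
      \<comment> \<open>Confinement with equal times puts \<open>z\<close> itself into the disk that
        contains its orbit.\<close>
      have zR: "norm z \<le> R" using R(3)[of s s z] ident[of s z] st zr r by simp
      have "norm (f s z - f t z) = norm (f t (\<phi> s t z) - f t z)"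
        using assoc[of s t z] st zr r by simp
      also have "\<dots> \<le> B / (R' - R) * norm (\<phi> s t z - z)"
        using st f_le R(3)[OF st zr] zR
        by (intro holomorphic_Lipschitz_cball[OF holo_f R']) auto
      also have "\<dots> \<le> B / (R' - R) * (17 / (1 - R) * integral {s..t} k)"
        using k(2)[OF st zR R(2)] B R' by (intro mult_left_mono) auto
      also have "\<dots> = integral {s..t} (\<lambda>x. L * k x)"
        by (simp add: L_def)
      finally show ?thesis .
    qed
    then show "\<exists>k. nonneg_Ld d T k \<and>
        (\<forall>z\<in>K. \<forall>s t. 0 \<le> s \<and> s \<le> t \<and> t \<le> T \<longrightarrow> cmod (f s z - f t z) \<le> integral {s..t} k)"
      using nonneg_Ld_cmult[OF d k(1) L] by blast
  qed (use holo_f inj_f in auto)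
  then show "normalized_chain f"
    using d FD(4)[of 0] FD(5) by (auto simp: normalized_chain_def loewner_chain_def f_def)
qed

definition standard :: "real \<Rightarrow> complex \<Rightarrow> complex" where
  "standard t z = R.limit_chain t (M t z)"

lemma standard_chain_standard: "standard_chain \<beta> standard \<phi>"
proof -
  have "standard t ` unit_disk = R.limit_chain t ` unit_disk" if "0 \<le> t" for t
    using image_M[OF that] by (metis (no_types, lifting) image_cong image_image standard_def)
  then have "(\<Union>t\<in>{0..}. standard t ` unit_disk) = (\<Union>t\<in>{0..}. R.limit_chain t ` unit_disk)"
    by simp
  then show ?thesis
    unfolding standard_chain_def standard_def[abs_def]
    using normalized_of_radial_chain[OF R.radial_chain_limit_chain] R.limit_chain_range
    by simp
qed

lemma eq_standardI:
  assumes "\<And>t z. 0 \<le> t \<Longrightarrow> norm z < 1 \<Longrightarrow> g t (N t z) = R.limit_chain t z"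
  shows "\<forall>t\<ge>0. \<forall>z\<in>unit_disk. g t z = standard t z"
proof (intro allI impI ballI)
  fix t :: real and z :: complex assume "0 \<le> t" "z \<in> unit_disk"
  then show "g t z = standard t z"
    using assms[of t "M t z"] M_norm by (simp add: standard_def NM)
qed

lemma standard_unique_zero:
  assumes "\<beta> = 0" "normalized_chain g" "associated_with g \<phi>"
  shows "\<forall>t\<ge>0. \<forall>z\<in>unit_disk. g t z = standard t z"
  using R.radial_chain_unique_zero[OF assms(1) radial_chain_of_normalized[OF assms(2,3)] R.radial_chain_limit_chain]
  by (rule eq_standardI)

lemma standard_unique:
  assumes g: "standard_chain \<beta> g \<phi>"
  shows "\<forall>t\<ge>0. \<forall>z\<in>unit_disk. g t z = standard t z"
proof (cases "\<beta> = 0")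
  case True
  then show ?thesis using g standard_unique_zero by (simp add: standard_chain_def)
next
  case False
  then have \<beta>: "\<beta> > 0" using R.beta_nonneg by simp
  have G: "R.radial_chain (\<lambda>t z. g t (N t z))"
    using g by (intro radial_chain_of_normalized) (auto simp: standard_chain_def)
  have "(\<lambda>z. g t (N t z)) ` unit_disk = g t ` unit_disk" if "0 \<le> t" for t
    using image_N[OF that] by (metis image_image)
  then have "(\<Union>t\<in>{0..}. (\<lambda>z. g t (N t z)) ` unit_disk) = ball 0 (1 / \<beta>)"
    using g False by (simp add: standard_chain_def)
  from R.radial_chain_unique_pos[OF \<beta> R.radial_chain_limit_chain G R.limit_chain_range_pos[OF \<beta>] this]
  show ?thesis by (rule eq_standardI)
qed

lemma standard_class_S_factor:
  assumes \<beta>: "\<beta> > 0" and g: "normalized_chain g" "associated_with g \<phi>"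
  shows "\<exists>h. class_S h \<and> (\<forall>t\<ge>0. \<forall>z\<in>unit_disk. g t z = h (of_real \<beta> * standard t z) / of_real \<beta>)"
proof -
  obtain h where h: "class_S h"
    "\<And>t z. 0 \<le> t \<Longrightarrow> norm z < 1 \<Longrightarrow> g t (N t z) = h (of_real \<beta> * R.limit_chain t z) / of_real \<beta>"
    using R.radial_chain_class_S_factor[OF \<beta> R.radial_chain_limit_chain radial_chain_of_normalized[OF g]
        R.limit_chain_range_pos[OF \<beta>]] by metis
  have "g t z = h (of_real \<beta> * standard t z) / of_real \<beta>" if "0 \<le> t" "norm z < 1" for t z
    using h(2)[OF that(1) M_norm[OF that]] that by (simp add: NM standard_def)
  with h(1) show ?thesis by auto
qed

end

theorem theorem3p6:
  fixes \<phi> :: "real \<Rightarrow> real \<Rightarrow> complex \<Rightarrow> complex" and d :: ereal and \<beta> :: real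
  assumes "1 \<le> d" and "evolution_family d \<phi>"
    and "((\<lambda>t. cmod (deriv (\<phi> 0 t) 0) / (1 - (cmod (\<phi> 0 t 0))\<^sup>2)) \<longlongrightarrow> \<beta>) at_top"
  shows "\<exists>f :: real \<Rightarrow> complex \<Rightarrow> complex. standard_chain \<beta> f \<phi> \<and>
           (\<forall>g :: real \<Rightarrow> complex \<Rightarrow> complex. standard_chain \<beta> g \<phi> \<longrightarrow> (\<forall>t\<ge>0. \<forall>z\<in>unit_disk. g t z = f t z)) \<and>
           (\<beta> = 0 \<longrightarrow> (\<forall>g :: real \<Rightarrow> complex \<Rightarrow> complex. normalized_chain g \<and> associated_with g \<phi> \<longrightarrow>
                          (\<forall>t\<ge>0. \<forall>z\<in>unit_disk. g t z = f t z))) \<and>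
           (\<beta> > 0 \<longrightarrow> (\<forall>g :: real \<Rightarrow> complex \<Rightarrow> complex. normalized_chain g \<and> associated_with g \<phi> \<longrightarrow>
                          (\<exists>h :: complex \<Rightarrow> complex. class_S h \<and> (\<forall>t\<ge>0. \<forall>z\<in>unit_disk. g t z = h (complex_of_real \<beta> * f t z) / complex_of_real \<beta>))))"
proof -
  interpret evolution_with_beta d \<phi> \<beta>
    using assms by unfold_locales
  show ?thesis
    using standard_chain_standard standard_unique standard_unique_zero standard_class_S_factor
    by (intro exI[of _ standard] conjI allI impI) blast+
qed

end
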